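(* Consider the equality constrained problem (ECP) of minimizing $f(x)$ over $x\in\mathcal{M}$ subject to $h_j(x)=0$ for $j\in\mathcal{E}$ (no inequality constraints), with feasible set $\Omega$, and assume $|\mathcal{E}|<\dim(\mathcal{M})$. Run the Riemannian augmented Lagrangian method (RALM) described in the context with $\epsilon_{\min}=0$, and suppose that at each iteration $k$ the subsolver produces a point $x_{k+1}\in\mathcal{M}$ satisfying $$\|\operatorname{grad}_x\mathcal{L}_{\rho_k}(x_{k+1},\gamma^k)\|<\epsilon_k\qquad\text{and}\qquad \operatorname{Hess}_x\mathcal{L}_{\rho_k}(x_{k+1},\gamma^k)\succeq-\epsilon_k I$$ (the latter meaning that all eigenvalues of the Riemannian Hessian are at or above $-\epsilon_k$). If the sequence $\{x_k\}_{k=0}^\infty$ generated by the algorithm has a limit point $\overline{x}\in\Omega$ (i.e., some subsequence converges to $\overline{x}$) at which LICQ is satisfied, then $\overline{x}$ satisfies the weak second-order necessary conditions (WSONC) of the original ECP.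
   Context: Setting. $\mathcal{M}$ is a complete, smooth, finite-dimensional Riemannian manifold with metric $\langle\cdot,\cdot\rangle$, norm $\|\cdot\|$ and Riemannian distance $\mathrm{dist}$. $\mathcal{E}$ is a finite index set with $m=|\mathcal{E}|$ elements; $f$ and $h_j$ ($j\in\mathcal{E}$) are twice continuously differentiable functions $\mathcal{M}\to\mathbb{R}$. $\Omega=\{x\in\mathcal{M}: h_j(x)=0\ \forall j\in\mathcal{E}\}$. $\operatorname{grad}$ and $\operatorname{Hess}$ are the Riemannian gradient and Hessian ($\operatorname{Hess}f(x)[v]=\nabla_v\operatorname{grad}f$ with $\nabla$ the Riemannian connection); the subscript $x$ means they are taken with respect to the variable $x\in\mathcal{M}$. Multipliers $\gamma\in\mathbb{R}^m$ are indexed by $j\in\mathcal{E}$. LICQ at $x$: the family $\{\operatorname{grad} h_j(x)\}_{j\in\mathcal{E}}$ is linearly independent in $\mathrm{T}_x\mathcal{M}$. Lagrangian: $\mathcal{L}(x,\gamma)=f(x)+\sum_{j\in\mathcal{E}}\gamma_jh_j(x)$. KKT conditions at $x^*\in\Omega$ with multiplier $\gamma^*\in\mathbb{R}^m$: $\operatorname{grad}f(x^* )+\sum_{j\in\mathcal{E}}\gamma_j^*\operatorname{grad}h_j(x^* )=0$ and $h_j(x^* )=0$ for all $j\in\mathcal{E}$. WSONC (for an ECP): a point $x^*\in\Omega$ satisfies WSONC if it satisfies the KKT conditions with some multiplier $\gamma^*\in\mathbb{R}^m$ such that $\langle v,\operatorname{Hess}_x\mathcal{L}(x^*,\gamma^*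 )[v]\rangle\ge 0$ for every $v\in\mathcal{C}^W(x^* )=\{v\in\mathrm{T}_{x^*}\mathcal{M}:\langle\operatorname{grad}h_j(x^* ),v\rangle=0\ \forall j\in\mathcal{E}\}$. (Here $\mathcal{L}$ is the Lagrangian, not the augmented Lagrangian.) Augmented Lagrangian: for $\rho>0$ and $\gamma\in\mathbb{R}^m$, $$\mathcal{L}_\rho(x,\gamma)=f(x)+\frac{\rho}{2}\sum_{j\in\mathcal{E}}\Big(h_j(x)+\frac{\gamma_j}{\rho}\Big)^2.$$ RALM (without inequality constraints). Let $\operatorname{clip}_{[a,b]}(t)=\max\{a,\min(b,t)\}$. Inputs: $x_0\in\mathcal{M}$; $\gamma^0\in\mathbb{R}^m$; accuracy tolerance $\epsilon_{\min}\ge 0$; $\epsilon_0>0$; $\rho_0>0$; constants $\theta_\epsilon\in(0,1)$, $\theta_\rho>1$, $\theta_\sigma\in(0,1)$; bounds $\gamma^{\min},\gamma^{\max}\in\mathbb{R}^m$ with $\gamma_j^{\min}\le\gamma_j^{\max}$ for each $j\in\mathcal{E}$; minimum step size $d_{\min}$. For $k=0,1,\dots$: 1. A subsolver computes $x_{k+1}$, an approximate solution (within tolerance $\epsilon_k$, in the sense specified in the claim) of $\min_{x\in\mathcal{M}}\mathcal{L}_{\rho_k}(x,\gamma^k)$. 2. If $\mathrm{dist}(x_k,x_{k+1})<d_{\min}$ and $\epsilon_k\le\epsilon_{\min}$, return $x_{k+1}$. (When $\epsilon_{\min}=0$ this never happens, so the sequence is infinite and $\epsilon_k\to0$.) 3.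 $\gamma_j^{k+1}=\operatorname{clip}_{[\gamma_j^{\min},\gamma_j^{\max}]}(\gamma_j^k+\rho_kh_j(x_{k+1}))$ for $j\in\mathcal{E}$. 4. $\epsilon_{k+1}=\max\{\epsilon_{\min},\theta_\epsilon\epsilon_k\}$. 5. If $k=0$ or $\max_{j\in\mathcal{E}}|h_j(x_{k+1})|\le\theta_\sigma\max_{j\in\mathcal{E}}|h_j(x_k)|$, set $\rho_{k+1}=\rho_k$; otherwise set $\rho_{k+1}=\theta_\rho\rho_k$. *)

theory Defs
  imports "HOL-Analysis.Analysis" "HOL-Library.Function_Algebras"
begin

text \<open>
  The pointwise vector space structure on functions, so that the tangent vectors below, which are
  families indexed by charts, belong to the class \<^class>\<open>real_vector\<close>.
\<close>

instantiation "fun" :: (type, scaleR) scaleR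
begin
definition scaleR_fun :: "real \<Rightarrow> ('a \<Rightarrow> 'b) \<Rightarrow> 'a \<Rightarrow> 'b"
  where "scaleR_fun a f = (\<lambda>x. a *\<^sub>R f x)"
instance ..
end

instance "fun" :: (type, real_vector) real_vector
  by standard (auto simp: scaleR_fun_def plus_fun_def algebra_simps)


section \<open>Smooth manifolds\<close>

text \<open>\<open>Ck_on k S f\<close>: \<open>f\<close> is \<open>k\<close> times continuously differentiable on the open set \<open>S\<close>.\<close>

primrec Ck_on :: "nat \<Rightarrow> 'e::euclidean_space set \<Rightarrow> ('e \<Rightarrow> 'f::real_normed_vector) \<Rightarrow> bool" where
  "Ck_on 0 S f \<longleftrightarrow> continuous_on S f"
| "Ck_on (Suc k) S f \<longleftrightarrow>
     (\<forall>x\<in>S. f differentiable (at x)) \<and> (\<forall>v. Ck_on k S (\<lambda>x. frechet_derivative f (at x) v))"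

definition smooth_on :: "'e::euclidean_space set \<Rightarrow> ('e \<Rightarrow> 'f::real_normed_vector) \<Rightarrow> bool" where
  "smooth_on S f \<longleftrightarrow> (\<forall>k. Ck_on k S f)"

text \<open>
  A chart is a pair of a domain and a coordinate map; values of the map off the domain are
  irrelevant. The manifold is the whole topological space \<^typ>\<open>'a\<close>, its dimension is \<open>DIM('e)\<close>.
\<close>

type_synonym ('a, 'e) chart = "'a set \<times> ('a \<Rightarrow> 'e)"

definition chart_image :: "('a, 'e) chart \<Rightarrow> 'e set" where
  "chart_image c = snd c ` fst c"

definition chart_inv :: "('a, 'e) chart \<Rightarrow> 'e \<Rightarrow> 'a" where
  "chart_inv c = inv_into (fst c) (snd c)"

definition is_chart ::
  "('a::topological_space, 'e::euclidean_space) chart \<Rightarrow> bool" where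
  "is_chart c \<longleftrightarrow> open (fst c) \<and> open (chart_image c) \<and>
     homeomorphism (fst c) (chart_image c) (snd c) (chart_inv c)"

definition smooth_manifold ::
  "('a::{t2_space, second_countable_topology}, 'e::euclidean_space) chart set \<Rightarrow> bool" where
  "smooth_manifold A \<longleftrightarrow>
     (\<forall>c\<in>A. is_chart c) \<and>
     (\<Union>c\<in>A. fst c) = UNIV \<and>
     (\<forall>c\<in>A. \<forall>d\<in>A. smooth_on (snd c ` (fst c \<inter> fst d)) (snd d \<circ> chart_inv c))"

definition Ck_fun ::
  "('a, 'e::euclidean_space) chart set \<Rightarrow> nat \<Rightarrow> ('a \<Rightarrow> real) \<Rightarrow> bool" where
  "Ck_fun A k \<phi> \<longleftrightarrow> (\<forall>c\<in>A. Ck_on k (chart_image c) (\<phi> \<circ> chart_inv c))"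


section \<open>Tangent vectors and vector fields\<close>

text \<open>
  A tangent vector at \<open>x\<close> is the family of its coordinate representations, one for each chart
  around \<open>x\<close>, transforming under change of charts by the derivative of the transition map. The
  family is padded with 0 at all other charts, so that equality of functions is equality of
  tangent vectors.
\<close>

type_synonym ('a, 'e) tvec = "('a, 'e) chart \<Rightarrow> 'e"
type_synonym ('a, 'e) vfield = "'a \<Rightarrow> ('a, 'e) tvec"
type_synonym ('a, 'e) metric = "'a \<Rightarrow> ('a, 'e) tvec \<Rightarrow> ('a, 'e) tvec \<Rightarrow> real"

text \<open>The tangent vector at \<open>x\<close> whose representation in the chart \<open>c\<close> is \<open>u\<close>.\<close>

definition lift_vec ::
  "('a, 'e::euclidean_space) chart set \<Rightarrow> ('a, 'e) chart \<Rightarrow> 'a \<Rightarrow> 'e \<Rightarrow> ('a, 'e) tvec" where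
  "lift_vec A c x u = (\<lambda>d. if d \<in> A \<and> x \<in> fst d
     then frechet_derivative (snd d \<circ> chart_inv c) (at (snd c x)) u else 0)"

definition tangent_space ::
  "('a, 'e::euclidean_space) chart set \<Rightarrow> 'a \<Rightarrow> ('a, 'e) tvec set" where
  "tangent_space A x = {v. \<forall>c\<in>A. x \<in> fst c \<longrightarrow> v = lift_vec A c x (v c)}"

definition Ck_vfield ::
  "('a, 'e::euclidean_space) chart set \<Rightarrow> nat \<Rightarrow> ('a, 'e) vfield \<Rightarrow> bool" where
  "Ck_vfield A k X \<longleftrightarrow> (\<forall>x. X x \<in> tangent_space A x) \<and>
     (\<forall>c\<in>A. Ck_on k (chart_image c) (\<lambda>y. X (chart_inv c y) c))"

text \<open>
  The derivative \<open>d\<phi>(x)[v]\<close>. By the chain rule it does not depend on the chart chosen around \<open>x\<close>.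
\<close>

definition dir_deriv ::
  "('a, 'e::euclidean_space) chart set \<Rightarrow> 'a \<Rightarrow> ('a, 'e) tvec \<Rightarrow> ('a \<Rightarrow> real) \<Rightarrow> real" where
  "dir_deriv A x v \<phi> = (let c = (SOME c. c \<in> A \<and> x \<in> fst c)
     in frechet_derivative (\<phi> \<circ> chart_inv c) (at (snd c x)) (v c))"


section \<open>Riemannian metric, distance, completeness\<close>

definition riemannian_metric ::
  "('a, 'e::euclidean_space) chart set \<Rightarrow> ('a, 'e) metric \<Rightarrow> bool" where
  "riemannian_metric A g \<longleftrightarrow>
     (\<forall>x. \<forall>u\<in>tangent_space A x. \<forall>v\<in>tangent_space A x. g x u v = g x v u) \<and>
     (\<forall>x. \<forall>u\<in>tangent_space A x. \<forall>v\<in>tangent_space A x. \<forall>w\<in>tangent_space A x. \<forall>a b.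
        g x (a *\<^sub>R u + b *\<^sub>R v) w = a * g x u w + b * g x v w) \<and>
     (\<forall>x. \<forall>u\<in>tangent_space A x. u \<noteq> 0 \<longrightarrow> g x u u > 0) \<and>
     (\<forall>c\<in>A. \<forall>a b. smooth_on (chart_image c)
        (\<lambda>y. g (chart_inv c y) (lift_vec A c (chart_inv c y) a) (lift_vec A c (chart_inv c y) b)))"

definition tnorm :: "('a, 'e) metric \<Rightarrow> 'a \<Rightarrow> ('a, 'e) tvec \<Rightarrow> real" where
  "tnorm g x v = sqrt (g x v v)"

text \<open>Continuously differentiable curve on a compact interval, one-sided at the endpoints.\<close>

definition C1_segment ::
  "('a::topological_space, 'e::euclidean_space) chart set \<Rightarrow> real \<Rightarrow> real \<Rightarrow> (real \<Rightarrow> 'a) \<Rightarrow> bool" where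
  "C1_segment A a b p \<longleftrightarrow> a < b \<and> continuous_on {a..b} p \<and>
     (\<forall>c\<in>A. (\<forall>t\<in>{a..b}. p t \<in> fst c \<longrightarrow> (snd c \<circ> p) differentiable (at t within {a..b})) \<and>
            continuous_on {t\<in>{a..b}. p t \<in> fst c}
              (\<lambda>t. vector_derivative (snd c \<circ> p) (at t within {a..b})))"

definition velocity ::
  "('a, 'e::euclidean_space) chart set \<Rightarrow> real \<Rightarrow> real \<Rightarrow> (real \<Rightarrow> 'a) \<Rightarrow> real \<Rightarrow> ('a, 'e) tvec" where
  "velocity A a b p t = (\<lambda>c. if c \<in> A \<and> p t \<in> fst c
     then vector_derivative (snd c \<circ> p) (at t within {a..b}) else 0)"

text \<open>
  Infimum of the lengths of piecewise continuously differentiable curves with breakpoints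
  \<open>s 0 < \<dots> < s n\<close>; it is \<open>\<infinity>\<close> for points in different connected components.
\<close>

definition riem_dist ::
  "('a::topological_space, 'e::euclidean_space) chart set \<Rightarrow> ('a, 'e) metric \<Rightarrow> 'a \<Rightarrow> 'a \<Rightarrow> ereal" where
  "riem_dist A g x y = Inf {ereal (\<Sum>i<n. integral {s i..s (Suc i)}
        (\<lambda>t. tnorm g (p t) (velocity A (s i) (s (Suc i)) p t))) | n s p.
      (\<forall>i<n. C1_segment A (s i) (s (Suc i)) p) \<and> p (s 0) = x \<and> p (s n) = y}"

definition riem_complete ::
  "('a::topological_space, 'e::euclidean_space) chart set \<Rightarrow> ('a, 'e) metric \<Rightarrow> bool" where
  "riem_complete A g \<longleftrightarrow> (\<forall>s :: nat \<Rightarrow> 'a.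
     (\<forall>e>0. \<exists>N. \<forall>m\<ge>N. \<forall>n\<ge>N. riem_dist A g (s m) (s n) < ereal e) \<longrightarrow> (\<exists>l. s \<longlonglongrightarrow> l))"


section \<open>Riemannian connection, gradient and Hessian\<close>

text \<open>
  \<open>nabla x v X\<close> is \<open>\<nabla>\<^sub>v X\<close> for a tangent vector \<open>v\<close> at \<open>x\<close>. The connection acts on continuously
  differentiable (not only smooth) vector fields, because the gradient of a twice continuously
  differentiable function is only of this class; hence also the regularity requirement for every
  order \<open>k\<close>. The last two conjuncts are symmetry (the commutator \<open>[X, Y]\<close> being understood as a
  derivation) and compatibility with the metric. By the fundamental theorem of
  Riemannian geometry these properties determine \<open>nabla\<close> on all such arguments.
\<close>

definition affine_connection ::
  "('a, 'e::euclidean_space) chart set \<Rightarrow> ('a \<Rightarrow> ('a, 'e) tvec \<Rightarrow> ('a, 'e) vfield \<Rightarrow> ('a, 'e) tvec) \<Rightarrow> bool"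
where
  "affine_connection A nabla \<longleftrightarrow>
     (\<forall>k X Y. Ck_vfield A k X \<longrightarrow> Ck_vfield A (Suc k) Y \<longrightarrow>
        Ck_vfield A k (\<lambda>x. nabla x (X x) Y)) \<and>
     (\<forall>x Y. Ck_vfield A 1 Y \<longrightarrow> (\<forall>u\<in>tangent_space A x. nabla x u Y \<in> tangent_space A x)) \<and>
     (\<forall>x Y. Ck_vfield A 1 Y \<longrightarrow> (\<forall>u\<in>tangent_space A x. \<forall>v\<in>tangent_space A x. \<forall>a b.
        nabla x (a *\<^sub>R u + b *\<^sub>R v) Y = a *\<^sub>R nabla x u Y + b *\<^sub>R nabla x v Y)) \<and>
     (\<forall>x Y Z. Ck_vfield A 1 Y \<longrightarrow> Ck_vfield A 1 Z \<longrightarrow> (\<forall>u\<in>tangent_space A x. \<forall>a b.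
        nabla x u (\<lambda>p. a *\<^sub>R Y p + b *\<^sub>R Z p) = a *\<^sub>R nabla x u Y + b *\<^sub>R nabla x u Z)) \<and>
     (\<forall>x \<phi> Y. Ck_fun A 1 \<phi> \<longrightarrow> Ck_vfield A 1 Y \<longrightarrow> (\<forall>u\<in>tangent_space A x.
        nabla x u (\<lambda>p. \<phi> p *\<^sub>R Y p) = dir_deriv A x u \<phi> *\<^sub>R Y x + \<phi> x *\<^sub>R nabla x u Y))"

definition riemannian_connection ::
  "('a, 'e::euclidean_space) chart set \<Rightarrow> ('a, 'e) metric \<Rightarrow>
   ('a \<Rightarrow> ('a, 'e) tvec \<Rightarrow> ('a, 'e) vfield \<Rightarrow> ('a, 'e) tvec) \<Rightarrow> bool"
where
  "riemannian_connection A g nabla \<longleftrightarrow> affine_connection A nabla \<and>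
     (\<forall>x X Y \<phi>. Ck_vfield A 1 X \<longrightarrow> Ck_vfield A 1 Y \<longrightarrow> Ck_fun A 2 \<phi> \<longrightarrow>
        dir_deriv A x (nabla x (X x) Y - nabla x (Y x) X) \<phi> =
        dir_deriv A x (X x) (\<lambda>p. dir_deriv A p (Y p) \<phi>) -
        dir_deriv A x (Y x) (\<lambda>p. dir_deriv A p (X p) \<phi>)) \<and>
     (\<forall>x Y Z. Ck_vfield A 1 Y \<longrightarrow> Ck_vfield A 1 Z \<longrightarrow> (\<forall>u\<in>tangent_space A x.
        dir_deriv A x u (\<lambda>p. g p (Y p) (Z p)) =
        g x (nabla x u Y) (Z x) + g x (Y x) (nabla x u Z)))"

definition grad ::
  "('a, 'e::euclidean_space) chart set \<Rightarrow> ('a, 'e) metric \<Rightarrow> ('a \<Rightarrow> real) \<Rightarrow> ('a, 'e) vfield" where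
  "grad A g \<phi> x = (THE w. w \<in> tangent_space A x \<and>
     (\<forall>v\<in>tangent_space A x. g x w v = dir_deriv A x v \<phi>))"

definition Hess ::
  "('a, 'e::euclidean_space) chart set \<Rightarrow> ('a, 'e) metric \<Rightarrow>
   ('a \<Rightarrow> ('a, 'e) tvec \<Rightarrow> ('a, 'e) vfield \<Rightarrow> ('a, 'e) tvec) \<Rightarrow>
   ('a \<Rightarrow> real) \<Rightarrow> 'a \<Rightarrow> ('a, 'e) tvec \<Rightarrow> ('a, 'e) tvec"
where
  "Hess A g nabla \<phi> x v = nabla x v (grad A g \<phi>)"

definition eigenvalues_on ::
  "'v::real_vector set \<Rightarrow> ('v \<Rightarrow> 'v) \<Rightarrow> real set" where
  "eigenvalues_on V H = {\<mu>. \<exists>v\<in>V. v \<noteq> 0 \<and> H v = \<mu> *\<^sub>R v}"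


section \<open>Equality constrained problems\<close>

definition feasible_set :: "'j set \<Rightarrow> ('j \<Rightarrow> 'a \<Rightarrow> real) \<Rightarrow> 'a set" where
  "feasible_set E h = {x. \<forall>j\<in>E. h j x = 0}"

text \<open>Linear independence as a family, whence injectivity.\<close>

definition LICQ ::
  "('a, 'e::euclidean_space) chart set \<Rightarrow> ('a, 'e) metric \<Rightarrow> 'j set \<Rightarrow> ('j \<Rightarrow> 'a \<Rightarrow> real) \<Rightarrow> 'a \<Rightarrow> bool"
where
  "LICQ A g E h x \<longleftrightarrow>
     inj_on (\<lambda>j. grad A g (h j) x) E \<and> independent ((\<lambda>j. grad A g (h j) x) ` E)"

definition lagrangian ::
  "('a \<Rightarrow> real) \<Rightarrow> 'j set \<Rightarrow> ('j \<Rightarrow> 'a \<Rightarrow> real) \<Rightarrow> ('j \<Rightarrow> real) \<Rightarrow> 'a \<Rightarrow> real" where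
  "lagrangian f E h \<gamma> x = f x + (\<Sum>j\<in>E. \<gamma> j * h j x)"

definition aug_lagrangian ::
  "('a \<Rightarrow> real) \<Rightarrow> 'j set \<Rightarrow> ('j \<Rightarrow> 'a \<Rightarrow> real) \<Rightarrow> real \<Rightarrow> ('j \<Rightarrow> real) \<Rightarrow> 'a \<Rightarrow> real" where
  "aug_lagrangian f E h \<rho> \<gamma> x = f x + \<rho> / 2 * (\<Sum>j\<in>E. (h j x + \<gamma> j / \<rho>)\<^sup>2)"

definition KKT ::
  "('a, 'e::euclidean_space) chart set \<Rightarrow> ('a, 'e) metric \<Rightarrow> ('a \<Rightarrow> real) \<Rightarrow> 'j set \<Rightarrow>
   ('j \<Rightarrow> 'a \<Rightarrow> real) \<Rightarrow> 'a \<Rightarrow> ('j \<Rightarrow> real) \<Rightarrow> bool"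
where
  "KKT A g f E h x \<gamma> \<longleftrightarrow>
     grad A g f x + (\<Sum>j\<in>E. \<gamma> j *\<^sub>R grad A g (h j) x) = 0 \<and> (\<forall>j\<in>E. h j x = 0)"

definition weak_critical_cone ::
  "('a, 'e::euclidean_space) chart set \<Rightarrow> ('a, 'e) metric \<Rightarrow> 'j set \<Rightarrow> ('j \<Rightarrow> 'a \<Rightarrow> real) \<Rightarrow> 'a \<Rightarrow>
   ('a, 'e) tvec set"
where
  "weak_critical_cone A g E h x = {v \<in> tangent_space A x. \<forall>j\<in>E. g x (grad A g (h j) x) v = 0}"

definition WSONC ::
  "('a, 'e::euclidean_space) chart set \<Rightarrow> ('a, 'e) metric \<Rightarrow>
   ('a \<Rightarrow> ('a, 'e) tvec \<Rightarrow> ('a, 'e) vfield \<Rightarrow> ('a, 'e) tvec) \<Rightarrow>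
   ('a \<Rightarrow> real) \<Rightarrow> 'j set \<Rightarrow> ('j \<Rightarrow> 'a \<Rightarrow> real) \<Rightarrow> 'a \<Rightarrow> bool"
where
  "WSONC A g nabla f E h x \<longleftrightarrow> x \<in> feasible_set E h \<and>
     (\<exists>\<gamma>. KKT A g f E h x \<gamma> \<and>
       (\<forall>v\<in>weak_critical_cone A g E h x. g x v (Hess A g nabla (lagrangian f E h \<gamma>) x v) \<ge> 0))"


section \<open>The Riemannian augmented Lagrangian method\<close>

record ('a, 'j) ralm_input =
  init_point :: 'a
  init_mult :: "'j \<Rightarrow> real"
  eps_min :: real
  eps_init :: real
  rho_init :: real
  theta_eps :: real
  theta_rho :: real
  theta_sigma :: real
  mult_min :: "'j \<Rightarrow> real"
  mult_max :: "'j \<Rightarrow> real"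
  d_min :: real

definition valid_ralm_input :: "'j set \<Rightarrow> ('a, 'j) ralm_input \<Rightarrow> bool" where
  "valid_ralm_input E P \<longleftrightarrow>
     eps_min P \<ge> 0 \<and> eps_init P > 0 \<and> rho_init P > 0 \<and>
     0 < theta_eps P \<and> theta_eps P < 1 \<and> theta_rho P > 1 \<and>
     0 < theta_sigma P \<and> theta_sigma P < 1 \<and>
     (\<forall>j\<in>E. mult_min P j \<le> mult_max P j)"

definition clip :: "real \<Rightarrow> real \<Rightarrow> real \<Rightarrow> real" where
  "clip a b t = max a (min b t)"

text \<open>The inserted 0 only matters for empty \<open>E\<close>, where the maximal violation is taken to be 0.\<close>

definition max_violation :: "'j set \<Rightarrow> ('j \<Rightarrow> 'a \<Rightarrow> real) \<Rightarrow> 'a \<Rightarrow> real" where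
  "max_violation E h x = Max (insert 0 ((\<lambda>j. \<bar>h j x\<bar>) ` E))"

text \<open>
  An infinite run of the method: the termination test never succeeds and all updates are
  performed. The quality of the subsolver's output \<open>x (Suc k)\<close> is a separate assumption.
\<close>

definition ralm_run ::
  "('a::topological_space, 'e::euclidean_space) chart set \<Rightarrow> ('a, 'e) metric \<Rightarrow> 'j set \<Rightarrow>
   ('j \<Rightarrow> 'a \<Rightarrow> real) \<Rightarrow> ('a, 'j) ralm_input \<Rightarrow>
   (nat \<Rightarrow> 'a) \<Rightarrow> (nat \<Rightarrow> 'j \<Rightarrow> real) \<Rightarrow> (nat \<Rightarrow> real) \<Rightarrow> (nat \<Rightarrow> real) \<Rightarrow> bool"
where
  "ralm_run A g E h P x \<gamma> \<epsilon> \<rho> \<longleftrightarrow>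
     x 0 = init_point P \<and> (\<forall>j\<in>E. \<gamma> 0 j = init_mult P j) \<and>
     \<epsilon> 0 = eps_init P \<and> \<rho> 0 = rho_init P \<and>
     (\<forall>k. \<not> (riem_dist A g (x k) (x (Suc k)) < ereal (d_min P) \<and> \<epsilon> k \<le> eps_min P)) \<and>
     (\<forall>k. \<forall>j\<in>E. \<gamma> (Suc k) j =
        clip (mult_min P j) (mult_max P j) (\<gamma> k j + \<rho> k * h j (x (Suc k)))) \<and>
     (\<forall>k. \<epsilon> (Suc k) = max (eps_min P) (theta_eps P * \<epsilon> k)) \<and>
     (\<forall>k. \<rho> (Suc k) =
        (if k = 0 \<or> max_violation E h (x (Suc k)) \<le> theta_sigma P * max_violation E h (x k)
         then \<rho> k else theta_rho P * \<rho> k))"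

end

theory Submission
  imports Defs
begin

text \<open>
  At the iterates the augmented Lagrangian has the gradient of the ordinary Lagrangian with
  multipliers \<open>\<gamma>\<^sub>j + \<rho> h\<^sub>j\<close>. In a chart around the limit point, linear independence of the constraint
  differentials persists nearby, so approximate stationarity forces these multipliers to converge,
  which gives the KKT conditions. A vector \<open>v\<close> of the critical cone is the limit of its projections
  \<open>v\<^sub>i\<close> onto the kernels of the constraint differentials at the iterates. The Hessian of the augmented
  Lagrangian differs from that of the Lagrangian by rank-one terms that vanish on \<open>v\<^sub>i\<close>, so the
  quadratic form of the latter at \<open>v\<^sub>i\<close> is at least \<open>- \<epsilon> \<parallel>v\<^sub>i\<parallel>\<^sup>2\<close>; it remains to pass to the limit.
\<close>

section \<open>Continuously differentiable maps\<close>

text \<open>Tangent vectors at different iterates lie in different spaces, so all limits are taken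
  in one fixed chart around the limit point: a vector at an iterate is given by its coordinates and
  sent back to the tangent space by \<open>lift_vec\<close>. The kernels must be met exactly. The
  rank-one terms carry the penalty parameter, which may be unbounded, so a vector that the
  constraint differentials annihilate only approximately gives no control. The connection is known
  through its axioms alone. Continuity of Hessian forms is therefore drawn from the clause that
  \<open>nabla\<close> preserves regularity, applied to cut-off coordinate fields, and not from a
  coordinate formula. The gradient is defined implicitly, so its differentiability comes from a
  result on linear systems with differentiable coefficients. The eigenvalue bound turns into a bound
  on the quadratic form by self-adjointness of the Hessian, and this is where vanishing torsion and
  metric compatibility enter.\<close>

lemma linear_expand:
  fixes L :: "'e::euclidean_space \<Rightarrow> 'f::real_vector"
  assumes "linear L"
  shows "L u = (\<Sum>b\<in>Basis. (u \<bullet> b) *\<^sub>R L b)"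
proof -
  have "L u = L (\<Sum>b\<in>Basis. (u \<bullet> b) *\<^sub>R b)" by (simp add: euclidean_representation)
  also have "\<dots> = (\<Sum>b\<in>Basis. (u \<bullet> b) *\<^sub>R L b)"
    by (simp add: linear_sum[OF assms] linear_scale[OF assms])
  finally show ?thesis .
qed

lemma Ck_on_1_iff:
  "Ck_on 1 S f \<longleftrightarrow> (\<forall>x\<in>S. f differentiable (at x)) \<and>
     (\<forall>v. continuous_on S (\<lambda>x. frechet_derivative f (at x) v))"
  by simp

text \<open>Uniqueness of the derivative on a Euclidean space identifies any explicitly given
  derivative with \<open>frechet_derivative\<close>, in terms of which \<open>Ck_on\<close> is
  phrased.\<close>

lemma Ck_on_1I:
  assumes "\<And>x. x \<in> S \<Longrightarrow> (f has_derivative f' x) (at x)"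
    and "\<And>v. continuous_on S (\<lambda>x. f' x v)"
  shows "Ck_on 1 S f"
proof -
  have "f' x = frechet_derivative f (at x)" if "x \<in> S" for x
    using frechet_derivative_at assms(1) that by blast
  then have "continuous_on S (\<lambda>x. frechet_derivative f (at x) v)" for v
    using assms(2)[of v] by (simp cong: continuous_on_cong)
  then show ?thesis
    unfolding Ck_on_1_iff using assms(1) differentiable_def by blast
qed

lemma Ck_on_1_has_derivative:
  assumes "Ck_on 1 S f" "x \<in> S"
  shows "(f has_derivative frechet_derivative f (at x)) (at x)"
  using assms by (simp add: Ck_on_1_iff frechet_derivative_works)

lemma Ck_on_1_derivative_continuous:
  "Ck_on 1 S f \<Longrightarrow> continuous_on S (\<lambda>x. frechet_derivative f (at x) v)"
  by (simp add: Ck_on_1_iff)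

lemma Ck_on_1_continuous:
  assumes "Ck_on 1 S f"
  shows "continuous_on S f"
  using assms by (meson Ck_on_1_has_derivative continuous_at_imp_continuous_on
      has_derivative_continuous)

lemma Ck_on_2_imp_1: "Ck_on 2 S f \<Longrightarrow> Ck_on 1 S f"
  unfolding numeral_2_eq_2 Ck_on.simps(2)[of "Suc 0"] Ck_on_1_iff
  using Ck_on_1_continuous One_nat_def by metis

lemma Ck_on_2_derivative: "Ck_on 2 S f \<Longrightarrow> Ck_on 1 S (\<lambda>x. frechet_derivative f (at x) v)"
  unfolding numeral_2_eq_2 Ck_on.simps(2)[of "Suc 0"] by simp

lemma Ck_on_1_cong:
  assumes "open S" "Ck_on 1 S f" "\<And>x. x \<in> S \<Longrightarrow> f x = k x"
  shows "Ck_on 1 S k"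
proof (rule Ck_on_1I)
  show "(k has_derivative frechet_derivative f (at x)) (at x)" if "x \<in> S" for x
    using Ck_on_1_has_derivative[OF assms(2) that] assms(1,3) that
    by (metis has_derivative_transform_within_open)
  show "continuous_on S (\<lambda>x. frechet_derivative f (at x) v)" for v
    using assms(2) by (simp add: Ck_on_1_iff)
qed

text \<open>Used to glue: a cut-off field has one formula on the chart overlap and another off the
  support.\<close>

lemma Ck_on_1_local:
  assumes "\<And>x. x \<in> S \<Longrightarrow> \<exists>U. open U \<and> x \<in> U \<and> Ck_on 1 U f"
  shows "Ck_on 1 S f"
  unfolding Ck_on_1_iff
proof (intro conjI ballI allI)
  show "f differentiable at x" if "x \<in> S" for x
    using assms[OF that] by (auto simp: Ck_on_1_iff)
  show "continuous_on S (\<lambda>x. frechet_derivative f (at x) v)" for v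
  proof (rule continuous_at_imp_continuous_on, rule ballI)
    fix x assume "x \<in> S"
    then obtain U where "open U" "x \<in> U" "Ck_on 1 U f" using assms by blast
    then show "isCont (\<lambda>x. frechet_derivative f (at x) v) x"
      by (simp add: Ck_on_1_iff continuous_on_eq_continuous_at)
  qed
qed

text \<open>In finite dimension a linear map is determined by finitely many basis values, so their
  continuity yields joint continuity in the parameter and the argument.\<close>

lemma continuous_on_linear_family:
  fixes L :: "'a::topological_space \<Rightarrow> 'e::euclidean_space \<Rightarrow> 'f::real_normed_vector"
  assumes "\<And>x. x \<in> S \<Longrightarrow> linear (L x)"
    and "\<And>b. b \<in> Basis \<Longrightarrow> continuous_on S (\<lambda>x. L x b)"
    and "continuous_on S u"
  shows "continuous_on S (\<lambda>x. L x (u x))"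
proof -
  have "continuous_on S (\<lambda>x. \<Sum>b\<in>Basis. (u x \<bullet> b) *\<^sub>R L x b)"
    by (intro continuous_intros assms)
  then show ?thesis
    by (rule continuous_on_eq) (metis assms(1) linear_expand)
qed

lemma Ck_on_1_compose:
  fixes f :: "'e::euclidean_space \<Rightarrow> 'f::euclidean_space"
  assumes f: "Ck_on 1 S f" and k: "Ck_on 1 T k" and "f ` S \<subseteq> T"
  shows "Ck_on 1 S (k \<circ> f)"
proof (rule Ck_on_1I)
  show "((k \<circ> f) has_derivative
      frechet_derivative k (at (f x)) \<circ> frechet_derivative f (at x)) (at x)" if "x \<in> S" for x
    using assms that by (intro diff_chain_at Ck_on_1_has_derivative) auto
  show "continuous_on S (\<lambda>x. (frechet_derivative k (at (f x)) \<circ> frechet_derivative f (at x)) v)" for v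
    unfolding o_def
  proof (rule continuous_on_linear_family)
    show "linear (frechet_derivative k (at (f x)))" if "x \<in> S" for x
      using Ck_on_1_has_derivative[OF k] assms(3) that has_derivative_linear by blast
    show "continuous_on S (\<lambda>x. frechet_derivative k (at (f x)) b)" for b
      using continuous_on_compose2[OF Ck_on_1_derivative_continuous[OF k]
          Ck_on_1_continuous[OF f] assms(3)] .
    show "continuous_on S (\<lambda>x. frechet_derivative f (at x) v)"
      using f by (simp add: Ck_on_1_iff)
  qed
qed

lemma Ck_on_1_scaleR:
  fixes \<phi> :: "'e::euclidean_space \<Rightarrow> real"
  assumes "Ck_on 1 S \<phi>" "Ck_on 1 S f"
  shows "Ck_on 1 S (\<lambda>x. \<phi> x *\<^sub>R f x)"
proof (rule Ck_on_1I)
  show "((\<lambda>x. \<phi> x *\<^sub>R f x) has_derivative (\<lambda>v. \<phi> x *\<^sub>R frechet_derivative f (at x) v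
      + frechet_derivative \<phi> (at x) v *\<^sub>R f x)) (at x)" if "x \<in> S" for x
    using assms that by (intro has_derivative_scaleR Ck_on_1_has_derivative)
  show "continuous_on S (\<lambda>x. \<phi> x *\<^sub>R frechet_derivative f (at x) v
      + frechet_derivative \<phi> (at x) v *\<^sub>R f x)" for v
    by (intro continuous_intros Ck_on_1_continuous Ck_on_1_derivative_continuous assms)
qed

lemma Ck_on_1_add:
  assumes "Ck_on 1 S f" "Ck_on 1 S k"
  shows "Ck_on 1 S (\<lambda>x. f x + k x)"
proof (rule Ck_on_1I)
  show "((\<lambda>x. f x + k x) has_derivative (\<lambda>v. frechet_derivative f (at x) v
      + frechet_derivative k (at x) v)) (at x)" if "x \<in> S" for x
    using assms that by (intro has_derivative_add Ck_on_1_has_derivative)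
  show "continuous_on S (\<lambda>x. frechet_derivative f (at x) v + frechet_derivative k (at x) v)" for v
    using assms by (intro continuous_intros) (auto simp: Ck_on_1_iff)
qed

lemma Ck_on_1_const: "Ck_on 1 S (\<lambda>_. a)"
  by (rule Ck_on_1I[where f' = "\<lambda>_ _. 0"]) auto

lemma Ck_on_1_sum:
  assumes "\<And>i. i \<in> I \<Longrightarrow> Ck_on 1 S (f i)"
  shows "Ck_on 1 S (\<lambda>x. \<Sum>i\<in>I. f i x)"
  using assms by (induction I rule: infinite_finite_induct) (simp_all add: Ck_on_1_const Ck_on_1_add del: One_nat_def)

section \<open>Linear systems depending on a parameter\<close>

lemma norm_linear_diff_le:
  fixes L :: "'e::euclidean_space \<Rightarrow> 'f::real_normed_vector"
  assumes "linear L" "linear K"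
  shows "norm (L u - K u) \<le> (\<Sum>b\<in>Basis. norm (L b - K b)) * norm u"
proof -
  have "linear (\<lambda>u. L u - K u)" using assms by (rule linear_compose_sub)
  then have "L u - K u = (\<Sum>b\<in>Basis. (u \<bullet> b) *\<^sub>R (L b - K b))"
    by (rule linear_expand)
  then have "norm (L u - K u) \<le> (\<Sum>b\<in>Basis. norm ((u \<bullet> b) *\<^sub>R (L b - K b)))"
    by (metis norm_sum)
  also have "\<dots> \<le> (\<Sum>b\<in>Basis. norm (L b - K b) * norm u)"
    by (intro sum_mono) (simp add: Basis_le_norm mult.commute mult_right_mono)
  finally show ?thesis by (simp add: sum_distrib_right)
qed

text \<open>If \<open>K\<close> bounds the inverse of \<open>L0\<close> and the perturbation is
  smaller than \<open>1 / (2 * K)\<close>, then half of \<open>norm u\<close> can be absorbed on the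
  left; this is the origin of the constant \<open>2 * K\<close>.\<close>

lemma eventually_inverse_bound:
  fixes L :: "'a \<Rightarrow> 'e::euclidean_space \<Rightarrow> 'e"
  assumes "linear L0" "inj L0" "\<forall>\<^sub>F x in F. linear (L x)"
    and "\<And>b. b \<in> Basis \<Longrightarrow> ((\<lambda>x. L x b) \<longlongrightarrow> L0 b) F"
  obtains C where "\<forall>\<^sub>F x in F. \<forall>u. norm u \<le> C * norm (L x u)"
proof -
  obtain M where M: "linear M" "\<And>x. M (L0 x) = x"
    using linear_injective_isomorphism[OF assms(1,2)] by blast
  obtain K where K: "K > 0" "\<And>x. norm (M x) \<le> K * norm x"
    using linear_bounded_pos[OF M(1)] by blast
  define \<eta> where "\<eta> = (\<lambda>x. \<Sum>b\<in>Basis. norm (L x b - L0 b))"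
  have "((\<lambda>x. K * \<eta> x) \<longlongrightarrow> K * (\<Sum>b\<in>Basis. norm (L0 b - L0 b))) F"
    unfolding \<eta>_def by (intro tendsto_intros assms)
  then have "((\<lambda>x. K * \<eta> x) \<longlongrightarrow> 0) F" by simp
  then have ev: "\<forall>\<^sub>F x in F. K * \<eta> x < 1/2"
    by (rule order_tendstoD) simp
  have "\<forall>\<^sub>F x in F. \<forall>u. norm u \<le> 2 * K * norm (L x u)"
    using assms(3) ev
  proof eventually_elim
    case (elim x)
    show ?case
    proof
      fix u
      have "norm u \<le> K * norm (L0 u)" using K(2)[of "L0 u"] M by simp
      also have "norm (L0 u) \<le> norm (L x u) + norm (L x u - L0 u)"
        by (metis norm_triangle_sub norm_minus_commute)
      also have "norm (L x u - L0 u) \<le> \<eta> x * norm u"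
        unfolding \<eta>_def using norm_linear_diff_le elim(1) assms(1) by blast
      finally have "norm u \<le> K * norm (L x u) + (K * \<eta> x) * norm u"
        using K(1) by (simp add: algebra_simps)
      also have "(K * \<eta> x) * norm u \<le> 1/2 * norm u"
        using elim(2) by (intro mult_right_mono) auto
      finally show "norm u \<le> 2 * K * norm (L x u)" by simp
    qed
  qed
  then show ?thesis using that by blast
qed

text \<open>\<open>L x\<close> maps \<open>w x - w x0\<close> to \<open>F x - L x (w x0)\<close>,
  which tends to 0, and the inverses of \<open>L x\<close> are uniformly bounded near
  \<open>x0\<close>.\<close>

lemma continuous_on_linear_solution:
  fixes L :: "'a::topological_space \<Rightarrow> 'e::euclidean_space \<Rightarrow> 'e"
  assumes lin: "\<And>x. x \<in> S \<Longrightarrow> linear (L x)" and inj: "\<And>x. x \<in> S \<Longrightarrow> inj (L x)"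
    and L: "\<And>b. b \<in> Basis \<Longrightarrow> continuous_on S (\<lambda>x. L x b)" and F: "continuous_on S F"
    and w: "\<And>x. x \<in> S \<Longrightarrow> L x (w x) = F x"
  shows "continuous_on S w"
  unfolding continuous_on_def
proof
  fix x0 assume x0: "x0 \<in> S"
  have Lb: "((\<lambda>x. L x b) \<longlongrightarrow> L x0 b) (at x0 within S)" if "b \<in> Basis" for b
    using L[OF that] x0 by (simp add: continuous_on_def)
  have ev: "\<forall>\<^sub>F x in at x0 within S. x \<in> S" by (simp add: eventually_at_filter)
  have evl: "\<forall>\<^sub>F x in at x0 within S. linear (L x)"
    using ev by eventually_elim (rule lin)
  obtain C where C: "\<forall>\<^sub>F x in at x0 within S. \<forall>u. norm u \<le> C * norm (L x u)"
    by (rule eventually_inverse_bound[OF lin[OF x0] inj[OF x0] evl Lb])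
  have "continuous_on S (\<lambda>x. L x (w x0))"
    by (rule continuous_on_linear_family[OF lin L continuous_on_const])
  then have Lw: "((\<lambda>x. L x (w x0)) \<longlongrightarrow> L x0 (w x0)) (at x0 within S)"
    using x0 by (simp add: continuous_on_def)
  have Fx: "(F \<longlongrightarrow> F x0) (at x0 within S)"
    using F x0 by (simp add: continuous_on_def)
  have "((\<lambda>x. C * norm (F x - L x (w x0))) \<longlongrightarrow> C * norm (F x0 - L x0 (w x0))) (at x0 within S)"
    by (intro tendsto_intros Lw Fx)
  then have *: "((\<lambda>x. C * norm (F x - L x (w x0))) \<longlongrightarrow> 0) (at x0 within S)"
    using w[OF x0] by simp
  have "((\<lambda>x. w x - w x0) \<longlongrightarrow> 0) (at x0 within S)"
  proof (rule Lim_null_comparison[OF _ *])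
    show "\<forall>\<^sub>F x in at x0 within S. norm (w x - w x0) \<le> C * norm (F x - L x (w x0))"
      using C ev
    proof eventually_elim
      case (elim x)
      have "L x (w x - w x0) = F x - L x (w x0)"
        using elim lin w by (simp add: linear_diff)
      then show ?case using elim(1) by metis
    qed
  qed
  then show "(w \<longlongrightarrow> w x0) (at x0 within S)" by (simp add: LIM_zero_iff)
qed

text \<open>Implicit differentiation of \<open>L x (w x) = F x\<close>: the derivative of
  \<open>w\<close> solves a system with the same operator \<open>L x\<close>. Differentiability is
  proved by estimating the error of this candidate, and continuity of the derivative follows by
  applying the continuity result to the differentiated system.\<close>

lemma Ck_on_1_linear_solution:
  fixes L :: "'d::euclidean_space \<Rightarrow> 'e::euclidean_space \<Rightarrow> 'e"
  assumes S: "open S" and lin: "\<And>x. x \<in> S \<Longrightarrow> linear (L x)" and inj: "\<And>x. x \<in> S \<Longrightarrow> inj (L x)"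
    and L: "\<And>b. b \<in> Basis \<Longrightarrow> Ck_on 1 S (\<lambda>x. L x b)" and F: "Ck_on 1 S F"
    and w: "\<And>x. x \<in> S \<Longrightarrow> L x (w x) = F x"
  shows "Ck_on 1 S w"
proof -
  \<comment> \<open>The right-hand side of the differentiated system: the derivative of
    \<open>F\<close> minus the derivative of \<open>L\<close> applied to the undifferentiated
    \<open>w\<close>.\<close>
  define R where "R = (\<lambda>x v. frechet_derivative F (at x) v
      - (\<Sum>b\<in>Basis. (w x \<bullet> b) *\<^sub>R frechet_derivative (\<lambda>x. L x b) (at x) v))"
  have contw: "continuous_on S w"
    by (rule continuous_on_linear_solution[OF lin inj Ck_on_1_continuous[OF L]
          Ck_on_1_continuous[OF F] w])
  have "\<exists>D. (w has_derivative D) (at x0) \<and> (\<forall>v. L x0 (D v) = R x0 v)" if x0: "x0 \<in> S" for x0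
  proof -
    obtain M where M: "linear M" "\<And>x. M (L x0 x) = x" "\<And>x. L x0 (M x) = x"
      using linear_injective_isomorphism[OF lin inj] x0 by blast
    \<comment> \<open>The solution is frozen at \<open>x0\<close>, so that \<open>F - G\<close>
      vanishes at \<open>x0\<close> and has derivative \<open>R x0\<close> there, although
      \<open>w\<close> is not yet known to be differentiable.\<close>
    define G where "G = (\<lambda>x. \<Sum>b\<in>Basis. (w x0 \<bullet> b) *\<^sub>R L x b)"
    have G: "G x = L x (w x0)" if "x \<in> S" for x
      unfolding G_def using linear_expand[OF lin[OF that], of "w x0"] by simp
    have FG: "((\<lambda>x. F x - G x) has_derivative R x0) (at x0)"
      unfolding R_def G_def
      by (intro has_derivative_diff Ck_on_1_has_derivative[OF F x0] has_derivative_sum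
          has_derivative_scaleR_right Ck_on_1_has_derivative[OF L x0])
    define D where "D = M \<circ> R x0"
    have linR: "linear (R x0)" using FG has_derivative_linear by blast
    have linD: "linear D" unfolding D_def using linR M(1) linear_compose by blast
    have LD: "L x0 (D v) = R x0 v" for v by (simp add: D_def M)
    obtain K where K: "\<And>v. norm (D v) \<le> K * norm v" "K > 0"
      using linear_bounded_pos[OF linD] by blast
    have evS: "\<forall>\<^sub>F x in at x0. x \<in> S"
      using S x0 eventually_at_topological by blast
    have Lb: "((\<lambda>x. L x b) \<longlongrightarrow> L x0 b) (at x0)" if "b \<in> Basis" for b
      using Ck_on_1_has_derivative[OF L[OF that] x0] has_derivative_continuous isCont_def by blast
    have evl: "\<forall>\<^sub>F x in at x0. linear (L x)"
      using evS by eventually_elim (rule lin)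
    obtain C where C: "\<forall>\<^sub>F x in at x0. \<forall>u. norm u \<le> C * norm (L x u)"
      by (rule eventually_inverse_bound[OF lin[OF x0] inj[OF x0] evl Lb])
    define \<eta> where "\<eta> = (\<lambda>x. \<Sum>b\<in>Basis. norm (L x b - L x0 b))"
    have "(\<eta> \<longlongrightarrow> (\<Sum>b\<in>Basis. norm (L x0 b - L x0 b))) (at x0)"
      unfolding \<eta>_def by (intro tendsto_intros Lb)
    then have \<eta>: "(\<eta> \<longlongrightarrow> 0) (at x0)" by simp
    define q where "q = (\<lambda>x. norm (F x - G x - (F x0 - G x0) - R x0 (x - x0)) / norm (x - x0))"
    have q: "(q \<longlongrightarrow> 0) (at x0)"
      using FG unfolding has_derivative_iff_norm q_def by simp
    have bd: "((\<lambda>x. \<bar>C\<bar> * (q x + K * \<eta> x)) \<longlongrightarrow> \<bar>C\<bar> * (0 + K * 0)) (at x0)"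
      by (intro tendsto_intros q \<eta>)
    have "(w has_derivative D) (at x0)"
      unfolding has_derivative_iff_norm
    proof
      show "bounded_linear D" using linD linear_conv_bounded_linear by blast
      show "((\<lambda>y. norm (w y - w x0 - D (y - x0)) / norm (y - x0)) \<longlongrightarrow> 0) (at x0)"
      proof (rule Lim_null_comparison)
        show "((\<lambda>x. \<bar>C\<bar> * (q x + K * \<eta> x)) \<longlongrightarrow> 0) (at x0)" using bd by simp
        have ne: "\<forall>\<^sub>F x in at x0. x \<noteq> x0" by (simp add: eventually_at_filter)
        show "\<forall>\<^sub>F x in at x0. norm (norm (w x - w x0 - D (x - x0)) / norm (x - x0))
                \<le> \<bar>C\<bar> * (q x + K * \<eta> x)"
          using C evS ne
        proof eventually_elim
          case (elim x)
          let ?e = "w x - w x0 - D (x - x0)"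
          have pos: "norm (x - x0) > 0" using elim by simp
          have qx: "norm (F x - G x - (F x0 - G x0) - R x0 (x - x0)) = q x * norm (x - x0)"
            using pos by (simp add: q_def)
          \<comment> \<open>Two errors remain: the Taylor remainder of \<open>F - G\<close>,
            controlled by \<open>q\<close>, and the replacement of \<open>L x0\<close> by
            \<open>L x\<close> on the linear part, controlled by \<open>\<eta>\<close>.\<close>
          have "L x ?e = F x - G x - L x (D (x - x0))"
            using elim(2) lin w G by (simp add: linear_diff)
          also have "\<dots> = (F x - G x - (F x0 - G x0) - R x0 (x - x0))
                 - (L x (D (x - x0)) - L x0 (D (x - x0)))"
            using w[OF x0] G[OF x0] LD by simp
          finally have "norm (L x ?e) \<le> norm (F x - G x - (F x0 - G x0) - R x0 (x - x0))
                 + norm (L x (D (x - x0)) - L x0 (D (x - x0)))"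
            by (metis norm_triangle_ineq4)
          also have "norm (L x (D (x - x0)) - L x0 (D (x - x0))) \<le> \<eta> x * norm (D (x - x0))"
            unfolding \<eta>_def using norm_linear_diff_le elim(2) lin x0 by blast
          also have "\<dots> \<le> \<eta> x * (K * norm (x - x0))"
            using K(1) by (intro mult_left_mono) (auto simp: \<eta>_def sum_nonneg)
          finally have "norm (L x ?e) \<le> (q x + K * \<eta> x) * norm (x - x0)"
            using qx by (simp add: distrib_right mult.assoc mult.left_commute)
          moreover have "norm ?e \<le> \<bar>C\<bar> * norm (L x ?e)"
            using elim(1) by (meson abs_ge_self mult_right_mono norm_ge_zero order_trans)
          ultimately have "norm ?e \<le> \<bar>C\<bar> * ((q x + K * \<eta> x) * norm (x - x0))"
            by (meson abs_ge_zero mult_left_mono order_trans)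
          then show ?case using pos by (simp add: divide_le_eq mult.assoc)
        qed
      qed
    qed
    then show ?thesis using LD by blast
  qed
  then obtain D where D: "\<And>x. x \<in> S \<Longrightarrow> (w has_derivative D x) (at x)"
      and LD: "\<And>x v. x \<in> S \<Longrightarrow> L x (D x v) = R x v"
    by metis
  show ?thesis
  proof (rule Ck_on_1I[OF D])
    show "continuous_on S (\<lambda>x. D x v)" for v
    proof (rule continuous_on_linear_solution[of S L "\<lambda>x. R x v"])
      show "continuous_on S (\<lambda>x. R x v)"
        unfolding R_def
        by (intro continuous_intros Ck_on_1_derivative_continuous F L contw)
    qed (fact lin inj LD Ck_on_1_continuous[OF L])+
  qed
qed

section \<open>Perturbation of linearly independent families\<close>

text \<open>The coefficients are indexed by the family and not by its image, since away from the
  limit point the family need not be injective.\<close>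

lemma span_image_sum:
  fixes w :: "'j \<Rightarrow> 'b::real_vector"
  assumes "finite I" "y \<in> span (w ` I)"
  obtains c where "y = (\<Sum>j\<in>I. c j *\<^sub>R w j)"
proof -
  let ?T = "range (\<lambda>c. \<Sum>j\<in>I. c j *\<^sub>R w j)"
  have "subspace ?T"
  proof (rule subspaceI)
    show "0 \<in> ?T" by (rule image_eqI[of _ _ "\<lambda>_. 0"]) auto
    show "p + q \<in> ?T" if "p \<in> ?T" "q \<in> ?T" for p q
    proof -
      from that obtain c d where "p = (\<Sum>j\<in>I. c j *\<^sub>R w j)" "q = (\<Sum>j\<in>I. d j *\<^sub>R w j)" by blast
      then have "p + q = (\<Sum>j\<in>I. (c j + d j) *\<^sub>R w j)"
        by (simp add: scaleR_left_distrib sum.distrib)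
      then show ?thesis by (rule image_eqI[of _ _ "\<lambda>j. c j + d j"]) auto
    qed
    show "a *\<^sub>R p \<in> ?T" if "p \<in> ?T" for a p
    proof -
      from that obtain c where "p = (\<Sum>j\<in>I. c j *\<^sub>R w j)" by blast
      then have "a *\<^sub>R p = (\<Sum>j\<in>I. (a * c j) *\<^sub>R w j)"
        by (simp add: scaleR_sum_right)
      then show ?thesis by (rule image_eqI[of _ _ "\<lambda>j. a * c j"]) auto
    qed
  qed
  moreover have "w ` I \<subseteq> ?T"
  proof
    fix p assume "p \<in> w ` I"
    then obtain i where i: "i \<in> I" "p = w i" by blast
    have "(\<Sum>j\<in>I. (if j = i then 1 else 0) *\<^sub>R w j) = (\<Sum>j\<in>I. if j = i then w j else 0)"
      by (rule sum.cong) auto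
    also have "\<dots> = p" using i assms(1) by simp
    finally show "p \<in> ?T" by (intro image_eqI[of _ _ "\<lambda>j. if j = i then 1 else 0"]) auto
  qed
  ultimately have "span (w ` I) \<subseteq> ?T" by (simp add: span_minimal)
  then show ?thesis using assms(2) that by blast
qed

text \<open>Phrased with coefficients on the index set, so that a repeated vector counts as a
  dependence and coefficients can be followed along a filter.\<close>

definition lin_indep_family :: "'j set \<Rightarrow> ('j \<Rightarrow> 'b::real_vector) \<Rightarrow> bool" where
  "lin_indep_family I w \<longleftrightarrow> (\<forall>c. (\<Sum>j\<in>I. c j *\<^sub>R w j) = 0 \<longrightarrow> (\<forall>j\<in>I. c j = 0))"

lemma lin_indep_familyI:
  assumes "finite I" "inj_on w I" "independent (w ` I)"
  shows "lin_indep_family I w"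
  unfolding lin_indep_family_def
proof (intro allI impI ballI)
  fix c i assume z: "(\<Sum>j\<in>I. c j *\<^sub>R w j) = 0" and i: "i \<in> I"
  have "(\<Sum>v\<in>w ` I. c (inv_into I w v) *\<^sub>R v) = (\<Sum>j\<in>I. c (inv_into I w (w j)) *\<^sub>R w j)"
    by (rule sum.reindex_cong[OF assms(2)]) auto
  also have "\<dots> = (\<Sum>j\<in>I. c j *\<^sub>R w j)"
    using assms(2) by (intro sum.cong) auto
  finally have "(\<Sum>v\<in>w ` I. c (inv_into I w v) *\<^sub>R v) = 0" using z by simp
  from independentD[OF assms(3) finite_imageI[OF assms(1)] order_refl this imageI[OF i]]
  have "c (inv_into I w (w i)) = 0" .
  then show "c i = 0" using assms(2) i by simp
qed

text \<open>\<open>e k\<close> is the component of \<open>w k\<close> orthogonal to the span of the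
  other vectors, divided by its squared norm.\<close>

lemma dual_family:
  fixes w :: "'j \<Rightarrow> 'b::euclidean_space"
  assumes I: "finite I" and "lin_indep_family I w"
  obtains e where "\<And>j k. j \<in> I \<Longrightarrow> k \<in> I \<Longrightarrow> w j \<bullet> e k = (if j = k then 1 else 0)"
proof -
  have "\<exists>e. \<forall>j\<in>I. w j \<bullet> e = (if j = k then 1 else 0)" if k: "k \<in> I" for k
  proof -
    obtain y z where y: "y \<in> span (w ` (I - {k}))"
      and z: "\<And>v. v \<in> span (w ` (I - {k})) \<Longrightarrow> orthogonal z v" and kyz: "w k = y + z"
      using orthogonal_subspace_decomp_exists by blast
    have "z \<noteq> 0"
    proof
      assume "z = 0"
      obtain c where c: "y = (\<Sum>j\<in>I - {k}. c j *\<^sub>R w j)"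
        using span_image_sum[OF _ y] I by blast
      \<comment> \<open>If \<open>z\<close> vanished, \<open>w k\<close> would equal
        \<open>y\<close>, and the coefficient -1 at \<open>k\<close> would make a nontrivial
        relation.\<close>
      let ?c = "c(k := -1)"
      have "(\<Sum>j\<in>I. ?c j *\<^sub>R w j) = ?c k *\<^sub>R w k + (\<Sum>j\<in>I - {k}. ?c j *\<^sub>R w j)"
        by (rule sum.remove[OF I k])
      also have "(\<Sum>j\<in>I - {k}. ?c j *\<^sub>R w j) = y" unfolding c by (rule sum.cong) auto
      finally have "(\<Sum>j\<in>I. ?c j *\<^sub>R w j) = 0" using kyz \<open>z = 0\<close> by simp
      then have "?c k = 0" using assms(2) k unfolding lin_indep_family_def by blast
      then show False by simp
    qed
    have "w j \<bullet> (z /\<^sub>R (z \<bullet> z)) = (if j = k then 1 else 0)" if "j \<in> I" for j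
    proof (cases "j = k")
      case True
      have "y \<bullet> z = 0" using z[OF y] by (simp add: orthogonal_def inner_commute)
      then show ?thesis using True kyz \<open>z \<noteq> 0\<close> by (simp add: inner_add_left)
    next
      case False
      then have "w j \<bullet> z = 0"
        using z[OF span_base[of "w j"]] that by (simp add: orthogonal_def inner_commute)
      then show ?thesis using False by simp
    qed
    then show ?thesis by blast
  qed
  then show ?thesis using that by metis
qed

text \<open>Pairing with a dual vector of the limit family \<open>w0\<close> reads off a coefficient
  with respect to the perturbed family \<open>w\<close>, up to an explicit error that is linear in
  \<open>w - w0\<close>.\<close>

lemma coefficient_via_dual:
  fixes w w0 :: "'j \<Rightarrow> 'b::euclidean_space"
  assumes I: "finite I" and k: "k \<in> I"
    and e: "\<And>j. j \<in> I \<Longrightarrow> w0 j \<bullet> e = (if j = k then 1 else 0)"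
  shows "c k = (\<Sum>j\<in>I. c j *\<^sub>R w j) \<bullet> e - (\<Sum>j\<in>I. c j * ((w j - w0 j) \<bullet> e))"
proof -
  have "(\<Sum>j\<in>I. c j *\<^sub>R w j) \<bullet> e - (\<Sum>j\<in>I. c j * ((w j - w0 j) \<bullet> e))
      = (\<Sum>j\<in>I. c j * (w0 j \<bullet> e))"
    by (simp add: inner_sum_left inner_diff_left right_diff_distrib sum_subtractf)
  also have "\<dots> = (\<Sum>j\<in>I. if j = k then c j else 0)"
    by (rule sum.cong) (auto simp: e)
  also have "\<dots> = c k" using I k by simp
  finally show ?thesis by simp
qed

lemma coefficient_perturbation_le:
  fixes w w0 :: "'j \<Rightarrow> 'b::euclidean_space"
  assumes "finite I"
  shows "\<bar>\<Sum>j\<in>I. c j * ((w j - w0 j) \<bullet> e)\<bar>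
    \<le> (\<Sum>j\<in>I. \<bar>c j\<bar>) * ((\<Sum>j\<in>I. norm (w j - w0 j)) * norm e)"
proof -
  have "\<bar>\<Sum>j\<in>I. c j * ((w j - w0 j) \<bullet> e)\<bar> \<le> (\<Sum>j\<in>I. \<bar>c j * ((w j - w0 j) \<bullet> e)\<bar>)"
    by (rule sum_abs)
  also have "\<dots> \<le> (\<Sum>j\<in>I. \<bar>c j\<bar> * ((\<Sum>j\<in>I. norm (w j - w0 j)) * norm e))"
  proof (rule sum_mono)
    fix j assume j: "j \<in> I"
    have "\<bar>(w j - w0 j) \<bullet> e\<bar> \<le> norm (w j - w0 j) * norm e"
      by (rule Cauchy_Schwarz_ineq2)
    also have "\<dots> \<le> (\<Sum>j\<in>I. norm (w j - w0 j)) * norm e"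
      using member_le_sum[OF j, of "\<lambda>j. norm (w j - w0 j)"] assms
      by (intro mult_right_mono) auto
    finally show "\<bar>c j * ((w j - w0 j) \<bullet> e)\<bar> \<le> \<bar>c j\<bar> * ((\<Sum>j\<in>I. norm (w j - w0 j)) * norm e)"
      by (simp add: abs_mult mult_left_mono)
  qed
  finally show ?thesis by (simp add: sum_distrib_right)
qed

lemma sum_norm_diff_tendsto_0:
  assumes "\<And>j. j \<in> I \<Longrightarrow> (w j \<longlongrightarrow> w0 j) F"
  shows "((\<lambda>x. \<Sum>j\<in>I. norm (w j x - w0 j)) \<longlongrightarrow> (0::real)) F"
proof -
  have "((\<lambda>x. \<Sum>j\<in>I. norm (w j x - w0 j)) \<longlongrightarrow> (\<Sum>j\<in>I. norm (w0 j - w0 j))) F"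
    by (intro tendsto_intros assms)
  then show ?thesis by simp
qed

text \<open>The coefficients are read off with the dual vectors of \<open>w0\<close>. Once the
  perturbation times \<open>B\<close> is below one half, the error is absorbed on the left, which
  gives the constant \<open>2 * B\<close>, uniform near the limit.\<close>

lemma lin_indep_family_lower_bound:
  fixes w :: "'j \<Rightarrow> 'x \<Rightarrow> 'b::euclidean_space"
  assumes I: "finite I" and ind: "lin_indep_family I w0"
    and lim: "\<And>j. j \<in> I \<Longrightarrow> (w j \<longlongrightarrow> w0 j) F"
  obtains C where "C \<ge> 0"
    "\<forall>\<^sub>F x in F. \<forall>c. (\<Sum>j\<in>I. \<bar>c j\<bar>) \<le> C * norm (\<Sum>j\<in>I. c j *\<^sub>R w j x)"
proof -
  obtain e where e: "\<And>j k. j \<in> I \<Longrightarrow> k \<in> I \<Longrightarrow> w0 j \<bullet> e k = (if j = k then 1 else 0)"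
    using dual_family[OF I ind] by blast
  define B where "B = (\<Sum>k\<in>I. norm (e k))"
  have "B \<ge> 0" unfolding B_def by (simp add: sum_nonneg)
  define \<eta> where "\<eta> = (\<lambda>x. \<Sum>j\<in>I. norm (w j x - w0 j))"
  have "((\<lambda>x. \<eta> x * B) \<longlongrightarrow> 0 * B) F"
    unfolding \<eta>_def by (intro tendsto_intros sum_norm_diff_tendsto_0 lim)
  then have "\<forall>\<^sub>F x in F. \<eta> x * B < 1/2" by (rule order_tendstoD(2)) simp
  then have "\<forall>\<^sub>F x in F. \<forall>c. (\<Sum>j\<in>I. \<bar>c j\<bar>) \<le> 2 * B * norm (\<Sum>j\<in>I. c j *\<^sub>R w j x)"
  proof eventually_elim
    case (elim x)
    show ?case
    proof
      fix c
      let ?s = "\<Sum>j\<in>I. c j *\<^sub>R w j x" and ?c = "\<Sum>j\<in>I. \<bar>c j\<bar>"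
      have "\<bar>c k\<bar> \<le> norm ?s * norm (e k) + ?c * (\<eta> x * norm (e k))" if k: "k \<in> I" for k
      proof -
        have "\<bar>c k\<bar> \<le> \<bar>?s \<bullet> e k\<bar> + \<bar>\<Sum>j\<in>I. c j * ((w j x - w0 j) \<bullet> e k)\<bar>"
          using coefficient_via_dual[OF I k e[OF _ k], where c = c and w = "\<lambda>j. w j x"] by simp
        also have "\<dots> \<le> norm ?s * norm (e k) + ?c * (\<eta> x * norm (e k))"
          unfolding \<eta>_def by (intro add_mono Cauchy_Schwarz_ineq2 coefficient_perturbation_le I)
        finally show ?thesis .
      qed
      then have "?c \<le> (\<Sum>k\<in>I. norm ?s * norm (e k) + ?c * (\<eta> x * norm (e k)))"
        by (rule sum_mono)
      also have "\<dots> = norm ?s * B + ?c * (\<eta> x * B)"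
        by (simp add: B_def sum.distrib sum_distrib_left)
      also have "?c * (\<eta> x * B) \<le> ?c * (1/2)"
        using elim by (intro mult_left_mono) (auto simp: sum_nonneg)
      finally have "?c \<le> 2 * (norm ?s * B)" by linarith
      then show "?c \<le> 2 * B * norm ?s" by (simp only: mult.assoc mult.commute[of B])
    qed
  qed
  then show ?thesis using that[of "2 * B"] \<open>B \<ge> 0\<close> by simp
qed

text \<open>No bound on the coefficients is assumed: the lower bound supplies one from the
  convergent combination, so the error in the dual pairing tends to 0 and the \<open>k\<close>-th
  coefficient tends to \<open>s \<bullet> e k\<close>.\<close>

lemma tendsto_coefficients:
  fixes w :: "'j \<Rightarrow> 'x \<Rightarrow> 'b::euclidean_space"
  assumes I: "finite I" and ind: "lin_indep_family I w0"
    and lim: "\<And>j. j \<in> I \<Longrightarrow> (w j \<longlongrightarrow> w0 j) F"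
    and s: "((\<lambda>x. \<Sum>j\<in>I. c j x *\<^sub>R w j x) \<longlongrightarrow> s) F"
  obtains d where "\<And>j. j \<in> I \<Longrightarrow> (c j \<longlongrightarrow> d j) F"
proof -
  obtain e where e: "\<And>j k. j \<in> I \<Longrightarrow> k \<in> I \<Longrightarrow> w0 j \<bullet> e k = (if j = k then 1 else 0)"
    using dual_family[OF I ind] by blast
  obtain C where C: "C \<ge> 0"
    "\<forall>\<^sub>F x in F. \<forall>c. (\<Sum>j\<in>I. \<bar>c j\<bar>) \<le> C * norm (\<Sum>j\<in>I. c j *\<^sub>R w j x)"
    by (rule lin_indep_family_lower_bound[OF I ind lim])
  define \<eta> where "\<eta> = (\<lambda>x. \<Sum>j\<in>I. norm (w j x - w0 j))"
  have \<eta>: "(\<eta> \<longlongrightarrow> 0) F" unfolding \<eta>_def by (intro sum_norm_diff_tendsto_0 lim)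
  have "(c k \<longlongrightarrow> s \<bullet> e k) F" if k: "k \<in> I" for k
  proof -
    have "((\<lambda>x. C * norm (\<Sum>j\<in>I. c j x *\<^sub>R w j x) * (\<eta> x * norm (e k)))
        \<longlongrightarrow> C * norm s * (0 * norm (e k))) F"
      by (intro tendsto_mult tendsto_const tendsto_norm s \<eta>)
    then have "((\<lambda>x. C * norm (\<Sum>j\<in>I. c j x *\<^sub>R w j x) * (\<eta> x * norm (e k))) \<longlongrightarrow> 0) F"
      by simp
    then have "((\<lambda>x. \<Sum>j\<in>I. c j x * ((w j x - w0 j) \<bullet> e k)) \<longlongrightarrow> 0) F"
    proof (rule Lim_null_comparison[rotated])
      show "\<forall>\<^sub>F x in F. norm (\<Sum>j\<in>I. c j x * ((w j x - w0 j) \<bullet> e k))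
          \<le> C * norm (\<Sum>j\<in>I. c j x *\<^sub>R w j x) * (\<eta> x * norm (e k))"
        using C(2)
      proof eventually_elim
        case (elim x)
        have "norm (\<Sum>j\<in>I. c j x * ((w j x - w0 j) \<bullet> e k)) \<le> (\<Sum>j\<in>I. \<bar>c j x\<bar>) * (\<eta> x * norm (e k))"
          unfolding \<eta>_def real_norm_def by (rule coefficient_perturbation_le[OF I])
        also have "\<dots> \<le> C * norm (\<Sum>j\<in>I. c j x *\<^sub>R w j x) * (\<eta> x * norm (e k))"
          by (intro mult_right_mono elim[THEN spec, of "\<lambda>j. c j x"] mult_nonneg_nonneg norm_ge_zero)
            (simp add: \<eta>_def sum_nonneg)
        finally show ?case .
      qed
    qed
    then have lim: "((\<lambda>x. (\<Sum>j\<in>I. c j x *\<^sub>R w j x) \<bullet> e k - (\<Sum>j\<in>I. c j x * ((w j x - w0 j) \<bullet> e k)))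
        \<longlongrightarrow> s \<bullet> e k - 0) F"
      by (intro tendsto_diff tendsto_inner tendsto_const s)
    have "(\<Sum>j\<in>I. c j x *\<^sub>R w j x) \<bullet> e k - (\<Sum>j\<in>I. c j x * ((w j x - w0 j) \<bullet> e k)) = c k x" for x
      by (rule coefficient_via_dual[OF I k, where w = "\<lambda>j. w j x" and c = "\<lambda>j. c j x", symmetric])
        (simp add: e k)
    then show ?thesis using lim by simp
  qed
  then show ?thesis by (rule that)
qed

text \<open>The vectors \<open>u x\<close> are the orthogonal projections of \<open>a\<close> onto the kernels.\<close>

lemma tendsto_kernel_vector:
  fixes w :: "'j \<Rightarrow> 'x \<Rightarrow> 'b::euclidean_space"
  assumes I: "finite I" and ind: "lin_indep_family I w0"
    and lim: "\<And>j. j \<in> I \<Longrightarrow> (w j \<longlongrightarrow> w0 j) F"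
    and a: "\<And>j. j \<in> I \<Longrightarrow> w0 j \<bullet> a = 0"
  obtains u where "(u \<longlongrightarrow> a) F" "\<And>x j. j \<in> I \<Longrightarrow> w j x \<bullet> u x = 0"
proof -
  have "\<exists>u. a - u \<in> span ((\<lambda>j. w j x) ` I) \<and> (\<forall>v\<in>span ((\<lambda>j. w j x) ` I). v \<bullet> u = 0)" for x
  proof -
    obtain y z where "y \<in> span ((\<lambda>j. w j x) ` I)"
      "\<And>v. v \<in> span ((\<lambda>j. w j x) ` I) \<Longrightarrow> orthogonal z v" "a = y + z"
      using orthogonal_subspace_decomp_exists by blast
    then show ?thesis by (intro exI[of _ z]) (auto simp: orthogonal_def inner_commute)
  qed
  then obtain u where u: "\<And>x. a - u x \<in> span ((\<lambda>j. w j x) ` I)"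
    "\<And>x v. v \<in> span ((\<lambda>j. w j x) ` I) \<Longrightarrow> v \<bullet> u x = 0" by metis
  obtain C where C: "C \<ge> 0"
    "\<forall>\<^sub>F x in F. \<forall>c. (\<Sum>j\<in>I. \<bar>c j\<bar>) \<le> C * norm (\<Sum>j\<in>I. c j *\<^sub>R w j x)"
    by (rule lin_indep_family_lower_bound[OF I ind lim])
  \<comment> \<open>The defect of \<open>a\<close> with respect to the perturbed constraints; it
    tends to 0 since \<open>a\<close> lies in the limit kernel.\<close>
  define \<delta> where "\<delta> = (\<lambda>x. \<Sum>j\<in>I. \<bar>w j x \<bullet> a\<bar>)"
  have "((\<lambda>x. C * \<delta> x) \<longlongrightarrow> C * (\<Sum>j\<in>I. \<bar>w0 j \<bullet> a\<bar>)) F"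
    unfolding \<delta>_def by (intro tendsto_intros lim)
  then have \<delta>: "((\<lambda>x. C * \<delta> x) \<longlongrightarrow> 0) F" using a by simp
  have "\<forall>\<^sub>F x in F. norm (u x - a) \<le> C * \<delta> x"
    using C(2)
  proof eventually_elim
    case (elim x)
    obtain c where c: "a - u x = (\<Sum>j\<in>I. c j *\<^sub>R w j x)"
      using span_image_sum[OF I u(1)] by blast
    \<comment> \<open>Orthogonality of \<open>u x\<close> and \<open>a - u x\<close> brings in only
      the small products \<open>w j x \<bullet> a\<close>; the coefficients of
      \<open>a - u x\<close> are bounded by its own norm, which then cancels once.\<close>
    have "(norm (a - u x))\<^sup>2 = (a - u x) \<bullet> a"
      using u(2)[OF u(1)[of x]] by (simp add: power2_norm_eq_inner inner_diff_right)
    also have "\<dots> = (\<Sum>j\<in>I. c j * (w j x \<bullet> a))"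
      unfolding c by (simp add: inner_sum_left)
    also have "\<dots> \<le> (\<Sum>j\<in>I. \<bar>c j\<bar> * \<delta> x)"
    proof (rule sum_mono)
      fix j assume j: "j \<in> I"
      have "c j * (w j x \<bullet> a) \<le> \<bar>c j\<bar> * \<bar>w j x \<bullet> a\<bar>" by (metis abs_ge_self abs_mult)
      also have "\<dots> \<le> \<bar>c j\<bar> * \<delta> x"
        unfolding \<delta>_def using I j member_le_sum[OF j, of "\<lambda>j. \<bar>w j x \<bullet> a\<bar>"]
        by (intro mult_left_mono) auto
      finally show "c j * (w j x \<bullet> a) \<le> \<bar>c j\<bar> * \<delta> x" .
    qed
    also have "\<dots> = (\<Sum>j\<in>I. \<bar>c j\<bar>) * \<delta> x" by (simp add: sum_distrib_right)
    also have "\<dots> \<le> C * norm (a - u x) * \<delta> x"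
      unfolding c by (intro mult_right_mono elim[THEN spec, of c]) (simp add: \<delta>_def sum_nonneg)
    finally have "norm (a - u x) * norm (a - u x) \<le> (C * \<delta> x) * norm (a - u x)"
      by (simp add: power2_eq_square mult_ac)
    moreover have "C * \<delta> x \<ge> 0" using C(1) by (simp add: \<delta>_def sum_nonneg)
    ultimately have "norm (a - u x) \<le> C * \<delta> x"
      by (cases "norm (a - u x) = 0") auto
    then show ?case by (simp add: norm_minus_commute)
  qed
  then have "((\<lambda>x. u x - a) \<longlongrightarrow> 0) F" by (rule Lim_null_comparison[OF _ \<delta>])
  then have "(u \<longlongrightarrow> a) F" by (simp add: LIM_zero_iff)
  then show ?thesis
    by (rule that) (rule u(2)[OF span_base[OF imageI]])
qed

text \<open>The minimiser of the Rayleigh quotient on the unit sphere is an eigenvector.\<close>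

lemma symmetric_least_eigenvalue:
  fixes B :: "'b::euclidean_space \<Rightarrow> 'b \<Rightarrow> real"
  assumes B: "bilinear B" and sym: "\<And>a b. B a b = B b a" and pos: "\<And>a. a \<noteq> 0 \<Longrightarrow> B a a > 0"
    and S: "linear S" and selfadj: "\<And>a b. B a (S b) = B b (S a)"
  obtains \<mu> a where "a \<noteq> 0" "S a = \<mu> *\<^sub>R a" "\<And>b. \<mu> * B b b \<le> B b (S b)"
proof -
  \<comment> \<open>\<open>B\<close> differs from the Euclidean inner product, hence the division by
    \<open>B a a\<close>. The quotient is invariant under scaling, so the Euclidean sphere serves as
    the compact domain of minimisation.\<close>
  let ?q = "\<lambda>a. B a (S a) / B a a"
  have contS: "continuous_on T S" for T using S linear_continuous_on linear_linear by blast
  have ne: "sphere (0::'b) 1 \<noteq> {}" by simp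
  have "continuous_on (sphere 0 1) ?q"
  proof (intro continuous_on_divide bilinear_continuous_on_compose[OF _ _ B] contS continuous_on_id)
    show "\<forall>a\<in>sphere 0 1. B a a \<noteq> 0"
    proof
      fix a :: 'b assume "a \<in> sphere 0 1"
      then have "a \<noteq> 0" by auto
      then show "B a a \<noteq> 0" using pos[of a] by simp
    qed
  qed
  then obtain a where a: "a \<in> sphere 0 1" and min: "\<And>b. b \<in> sphere 0 1 \<Longrightarrow> ?q a \<le> ?q b"
    using continuous_attains_inf[OF compact_sphere ne] by blast
  define \<mu> where "\<mu> = ?q a"
  have "a \<noteq> 0" using a by auto
  note lin = bilinear_ladd[OF B] bilinear_radd[OF B] bilinear_lmul[OF B] bilinear_rmul[OF B]
    bilinear_rsub[OF B] bilinear_lzero[OF B] bilinear_rzero[OF B]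
    linear_add[OF S] linear_scale[OF S] linear_0[OF S]
  have le: "\<mu> * B b b \<le> B b (S b)" for b
  proof (cases "b = 0")
    case True
    then show ?thesis by (simp add: lin)
  next
    case False
    have "b /\<^sub>R norm b \<in> sphere 0 1" using False by simp
    from min[OF this] have "\<mu> \<le> ?q b"
      using False by (simp add: \<mu>_def lin)
    then show ?thesis using pos[OF False] by (simp add: le_divide_eq)
  qed
  have eq: "\<mu> * B a a = B a (S a)" using pos[OF \<open>a \<noteq> 0\<close>] by (simp add: \<mu>_def)
  \<comment> \<open>The first variation at the minimiser: \<open>2 * t * l + t\<^sup>2 * p\<close>
    stays nonnegative for all \<open>t\<close>, which forces the linear coefficient \<open>l\<close>
    to vanish.\<close>
  have "B b (S a - \<mu> *\<^sub>R a) = 0" for b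
  proof (rule ccontr)
    define l where "l = B b (S a - \<mu> *\<^sub>R a)"
    define p where "p = B b (S b) - \<mu> * B b b"
    assume "B b (S a - \<mu> *\<^sub>R a) \<noteq> 0"
    then have "l \<noteq> 0" by (simp add: l_def)
    have "p \<ge> 0" using le[of b] by (simp add: p_def)
    have "0 \<le> 2 * t * l + t\<^sup>2 * p" for t
    proof -
      have "B (a + t *\<^sub>R b) (S (a + t *\<^sub>R b)) - \<mu> * B (a + t *\<^sub>R b) (a + t *\<^sub>R b)
          = (B a (S a) - \<mu> * B a a) + 2 * t * l + t\<^sup>2 * p"
        using selfadj[of a b] sym[of a b]
        by (simp add: lin l_def p_def power2_eq_square algebra_simps)
      then show ?thesis using le[of "a + t *\<^sub>R b"] eq by simp
    qed
    \<comment> \<open>The summand 1 guards against \<open>p = 0\<close>; this value of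
      \<open>t\<close> makes the quadratic equal to \<open>- (t\<^sup>2 * (p + 2))\<close>.\<close>
    moreover define t where "t = - l / (p + 1)"
    ultimately have "0 \<le> 2 * t * l + t\<^sup>2 * p" by blast
    also have "l = - t * (p + 1)" using \<open>p \<ge> 0\<close> unfolding t_def by auto
    also have "2 * t * (- t * (p + 1)) + t\<^sup>2 * p = - (t\<^sup>2 * (p + 2))"
      by (simp add: algebra_simps power2_eq_square)
    also have "\<dots> < 0"
    proof -
      have "t \<noteq> 0" using \<open>l \<noteq> 0\<close> \<open>p \<ge> 0\<close> by (simp add: t_def)
      then show ?thesis using \<open>p \<ge> 0\<close> by simp
    qed
    finally show False by simp
  qed
  then have "\<not> B (S a - \<mu> *\<^sub>R a) (S a - \<mu> *\<^sub>R a) > 0" by simp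
  then have "S a - \<mu> *\<^sub>R a = 0" using pos by blast
  then show ?thesis using that[of a \<mu>] \<open>a \<noteq> 0\<close> le by simp
qed

section \<open>Tangent spaces and vector fields\<close>

lemma scaleR_fun_apply: "(a *\<^sub>R f) x = a *\<^sub>R f x"
  by (simp add: scaleR_fun_def)

locale manifold =
  fixes A :: "('a::{t2_space, second_countable_topology}, 'e::euclidean_space) chart set"
  assumes manifold: "smooth_manifold A"
begin

abbreviation transition :: "('a, 'e) chart \<Rightarrow> ('a, 'e) chart \<Rightarrow> 'e \<Rightarrow> 'e" where
  "transition c d \<equiv> snd d \<circ> chart_inv c"

text \<open>Allowing vector values lets one notation cover differentials of functions and, for
  \<open>\<phi> = snd d\<close>, Jacobians of transition maps.\<close>

abbreviation dchart :: "('a, 'e) chart \<Rightarrow> ('a \<Rightarrow> 'f::real_normed_vector) \<Rightarrow> 'a \<Rightarrow> 'e \<Rightarrow> 'f" where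
  "dchart c \<phi> x \<equiv> frechet_derivative (\<phi> \<circ> chart_inv c) (at (snd c x))"

lemma chart_exists: obtains c where "c \<in> A" "x \<in> fst c"
  using manifold unfolding smooth_manifold_def by blast

lemma
  assumes "c \<in> A"
  shows open_chart_domain: "open (fst c)" and open_chart_image: "open (chart_image c)"
    and chart_homeomorphism: "homeomorphism (fst c) (chart_image c) (snd c) (chart_inv c)"
  using manifold assms unfolding smooth_manifold_def is_chart_def by blast+

lemma chart_inv_chart: "c \<in> A \<Longrightarrow> x \<in> fst c \<Longrightarrow> chart_inv c (snd c x) = x"
  by (rule homeomorphism_apply1[OF chart_homeomorphism])

lemma chart_chart_inv: "c \<in> A \<Longrightarrow> y \<in> chart_image c \<Longrightarrow> snd c (chart_inv c y) = y"
  by (rule homeomorphism_apply2[OF chart_homeomorphism])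

lemma chart_inv_in: "c \<in> A \<Longrightarrow> y \<in> chart_image c \<Longrightarrow> chart_inv c y \<in> fst c"
  using homeomorphism_image2[OF chart_homeomorphism] by blast

lemma chart_in: "x \<in> fst c \<Longrightarrow> snd c x \<in> chart_image c"
  by (simp add: chart_image_def)

lemma continuous_on_chart: "c \<in> A \<Longrightarrow> continuous_on (fst c) (snd c)"
  by (rule homeomorphism_cont1[OF chart_homeomorphism])

lemma continuous_on_chart_inv: "c \<in> A \<Longrightarrow> continuous_on (chart_image c) (chart_inv c)"
  by (rule homeomorphism_cont2[OF chart_homeomorphism])

text \<open>As a preimage under the continuous \<open>chart_inv c\<close>, the image of an overlap
  is seen to be open.\<close>

lemma chart_overlap_image:
  assumes "c \<in> A"
  shows "snd c ` (fst c \<inter> U) = chart_image c \<inter> chart_inv c -` U"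
proof (intro set_eqI iffI)
  fix y assume "y \<in> snd c ` (fst c \<inter> U)"
  then show "y \<in> chart_image c \<inter> chart_inv c -` U"
    using chart_inv_chart[OF assms] by (auto simp: chart_image_def)
next
  fix y assume "y \<in> chart_image c \<inter> chart_inv c -` U"
  then show "y \<in> snd c ` (fst c \<inter> U)"
    using chart_chart_inv[OF assms] chart_inv_in[OF assms] by (intro image_eqI[of _ _ "chart_inv c y"]) auto
qed

lemma open_chart_overlap:
  assumes "c \<in> A" "open U"
  shows "open (snd c ` (fst c \<inter> U))"
  unfolding chart_overlap_image[OF assms(1)]
  by (rule continuous_open_preimage[OF continuous_on_chart_inv open_chart_image]) (fact assms)+

lemma transition_Ck:
  "c \<in> A \<Longrightarrow> d \<in> A \<Longrightarrow> Ck_on k (snd c ` (fst c \<inter> fst d)) (transition c d)"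
  using manifold unfolding smooth_manifold_def smooth_on_def by blast

lemma transition_has_derivative:
  assumes "c \<in> A" "d \<in> A" "x \<in> fst c" "x \<in> fst d"
  shows "(transition c d has_derivative dchart c (snd d) x) (at (snd c x))"
  by (rule Ck_on_1_has_derivative[OF transition_Ck[OF assms(1,2)]]) (use assms in auto)

lemma chart_change_has_derivative:
  fixes \<phi> :: "'a \<Rightarrow> 'f::real_normed_vector"
  assumes c: "c \<in> A" "x \<in> fst c" and d: "d \<in> A" "x \<in> fst d"
    and D: "(\<phi> \<circ> chart_inv d has_derivative D) (at (snd d x))"
  shows "(\<phi> \<circ> chart_inv c has_derivative D \<circ> dchart c (snd d) x) (at (snd c x))"
proof -
  have "((\<phi> \<circ> chart_inv d) \<circ> transition c d has_derivative D \<circ> dchart c (snd d) x) (at (snd c x))"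
    using D c d by (intro diff_chain_at transition_has_derivative) (auto simp: chart_inv_chart)
  then show ?thesis
  proof (rule has_derivative_transform_within_open)
    show "open (snd c ` (fst c \<inter> fst d))"
      using c d by (intro open_chart_overlap open_chart_domain)
    show "snd c x \<in> snd c ` (fst c \<inter> fst d)" using c d by blast
    show "((\<phi> \<circ> chart_inv d) \<circ> transition c d) y = (\<phi> \<circ> chart_inv c) y"
      if "y \<in> snd c ` (fst c \<inter> fst d)" for y
      using that c d by (auto simp: chart_inv_chart)
  qed
qed

text \<open>The cocycle rule for Jacobians, obtained from the chain rule; it makes
  \<open>lift_vec\<close> independent of the chart in which it is re-expanded.\<close>

lemma transition_chain:
  assumes "c \<in> A" "x \<in> fst c" "d \<in> A" "x \<in> fst d" "e \<in> A" "x \<in> fst e"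
  shows "dchart d (snd e) x (dchart c (snd d) x u) = dchart c (snd e) x u"
proof -
  have "(transition c e has_derivative dchart d (snd e) x \<circ> dchart c (snd d) x) (at (snd c x))"
    using assms by (intro chart_change_has_derivative transition_has_derivative)
  from fun_cong[OF frechet_derivative_at[OF this], of u] show ?thesis by simp
qed

lemma transition_self:
  assumes "c \<in> A" "x \<in> fst c"
  shows "dchart c (snd c) x u = u"
proof -
  have "(transition c c has_derivative id) (at (snd c x))"
  proof (rule has_derivative_transform_within_open[OF has_derivative_id[unfolded id_def[symmetric]]])
    show "open (chart_image c)" by (rule open_chart_image[OF assms(1)])
    show "snd c x \<in> chart_image c" using assms by (simp add: chart_in)
    show "id y = transition c c y" if "y \<in> chart_image c" for y
      using that assms by (simp add: chart_chart_inv)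
  qed
  from fun_cong[OF frechet_derivative_at[OF this], of u] show ?thesis by simp
qed

lemma lift_vec_apply:
  "d \<in> A \<Longrightarrow> x \<in> fst d \<Longrightarrow> lift_vec A c x u d = dchart c (snd d) x u"
  by (simp add: lift_vec_def)

lemma lift_vec_self [simp]: "c \<in> A \<Longrightarrow> x \<in> fst c \<Longrightarrow> lift_vec A c x u c = u"
  by (simp add: lift_vec_apply transition_self)

lemma lift_vec_in_tangent_space:
  assumes "c \<in> A" "x \<in> fst c"
  shows "lift_vec A c x u \<in> tangent_space A x"
  unfolding tangent_space_def
proof (intro CollectI ballI impI ext)
  fix d e assume d: "d \<in> A" "x \<in> fst d"
  show "lift_vec A c x u e = lift_vec A d x (lift_vec A c x u d) e"
  proof (cases "e \<in> A \<and> x \<in> fst e")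
    case True
    then show ?thesis using assms d by (simp add: lift_vec_apply transition_chain)
  next
    case False
    then show ?thesis by (auto simp: lift_vec_def)
  qed
qed

lemma lift_vec_of_tangent:
  "v \<in> tangent_space A x \<Longrightarrow> c \<in> A \<Longrightarrow> x \<in> fst c \<Longrightarrow> lift_vec A c x (v c) = v"
  unfolding tangent_space_def by auto

lemma linear_lift_vec:
  assumes "c \<in> A" "x \<in> fst c"
  shows "linear (lift_vec A c x)"
proof -
  have lin: "linear (dchart c (snd d) x)" if "d \<in> A" "x \<in> fst d" for d
    using transition_has_derivative[OF assms(1) that(1) assms(2) that(2)] has_derivative_linear by blast
  show ?thesis
  proof (rule linearI; rule ext)
    show "lift_vec A c x (u + v) d = (lift_vec A c x u + lift_vec A c x v) d" for u v d
      using linear_add[OF lin, of d u v] by (simp add: lift_vec_def plus_fun_apply del: comp_apply)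
    show "lift_vec A c x (r *\<^sub>R u) d = (r *\<^sub>R lift_vec A c x u) d" for r u d
      using linear_scale[OF lin, of d r u] by (simp add: lift_vec_def scaleR_fun_apply del: comp_apply)
  qed
qed

lemma subspace_tangent_space: "subspace (tangent_space A x)"
proof -
  obtain c where c: "c \<in> A" "x \<in> fst c" by (rule chart_exists)
  have "tangent_space A x = range (lift_vec A c x)"
  proof (intro antisym subsetI)
    fix v assume "v \<in> tangent_space A x"
    then show "v \<in> range (lift_vec A c x)"
      using lift_vec_of_tangent[OF _ c] by (intro image_eqI[of _ _ "v c"]) auto
  qed (use lift_vec_in_tangent_space[OF c] in blast)
  then show ?thesis
    using linear_subspace_image[OF linear_lift_vec[OF c] subspace_UNIV] by simp
qed

lemmas tangent_intros = subspace_0[OF subspace_tangent_space] subspace_add[OF subspace_tangent_space]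
  subspace_diff[OF subspace_tangent_space] subspace_scale[OF subspace_tangent_space]
  subspace_sum[OF subspace_tangent_space]

text \<open>Frees \<open>dir_deriv\<close> from its arbitrarily selected chart: the chain rule
  transports the derivative from \<open>c\<close> to that chart, and the transformation law of
  tangent vectors compensates. Differentiability at the one point is enough.\<close>

lemma dir_deriv_eq:
  assumes c: "c \<in> A" "x \<in> fst c" and v: "v \<in> tangent_space A x"
    and D: "(\<phi> \<circ> chart_inv c has_derivative D) (at (snd c x))"
  shows "dir_deriv A x v \<phi> = D (v c)"
proof -
  define d where "d = (SOME c. c \<in> A \<and> x \<in> fst c)"
  have d: "d \<in> A" "x \<in> fst d"
    using someI[of "\<lambda>c. c \<in> A \<and> x \<in> fst c" c] c unfolding d_def by blast+
  have "dir_deriv A x v \<phi> = dchart d \<phi> x (v d)"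
    unfolding dir_deriv_def d_def[symmetric] Let_def ..
  also have "dchart d \<phi> x = D \<circ> dchart d (snd c) x"
    using frechet_derivative_at[OF chart_change_has_derivative[OF d c D]] by simp
  also have "(D \<circ> dchart d (snd c) x) (v d) = D (lift_vec A d x (v d) c)"
    using c by (simp add: lift_vec_apply)
  finally show ?thesis using lift_vec_of_tangent[OF v d] by simp
qed

lemma Ck_fun_has_derivative:
  assumes "Ck_fun A 1 \<phi>" "c \<in> A" "x \<in> fst c"
  shows "(\<phi> \<circ> chart_inv c has_derivative dchart c \<phi> x) (at (snd c x))"
proof (rule Ck_on_1_has_derivative[OF _ chart_in[OF assms(3)]])
  show "Ck_on 1 (chart_image c) (\<phi> \<circ> chart_inv c)"
    using assms(1,2) unfolding Ck_fun_def by blast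
qed

lemma Ck_fun_2_imp_1: "Ck_fun A 2 \<phi> \<Longrightarrow> Ck_fun A 1 \<phi>"
  unfolding Ck_fun_def using Ck_on_2_imp_1 by blast

lemma dir_deriv_chart:
  assumes "Ck_fun A 1 \<phi>" "c \<in> A" "x \<in> fst c" "v \<in> tangent_space A x"
  shows "dir_deriv A x v \<phi> = dchart c \<phi> x (v c)"
  using assms by (intro dir_deriv_eq Ck_fun_has_derivative)

lemma Ck_vfield_tangent: "Ck_vfield A k X \<Longrightarrow> X x \<in> tangent_space A x"
  by (simp add: Ck_vfield_def)

lemma Ck_vfield_chart:
  "Ck_vfield A k X \<Longrightarrow> c \<in> A \<Longrightarrow> Ck_on k (chart_image c) (\<lambda>y. X (chart_inv c y) c)"
  by (simp add: Ck_vfield_def)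

lemma Ck_vfieldI:
  assumes "\<And>x. X x \<in> tangent_space A x"
    and "\<And>c. c \<in> A \<Longrightarrow> Ck_on k (chart_image c) (\<lambda>y. X (chart_inv c y) c)"
  shows "Ck_vfield A k X"
  using assms by (simp add: Ck_vfield_def)

lemma Ck_vfield_add:
  assumes "Ck_vfield A 1 X" "Ck_vfield A 1 Y"
  shows "Ck_vfield A 1 (\<lambda>x. X x + Y x)"
proof (rule Ck_vfieldI)
  show "X x + Y x \<in> tangent_space A x" for x
    using assms by (intro tangent_intros Ck_vfield_tangent)
  show "Ck_on 1 (chart_image c) (\<lambda>y. (X (chart_inv c y) + Y (chart_inv c y)) c)" if "c \<in> A" for c
    unfolding plus_fun_apply using assms that by (intro Ck_on_1_add Ck_vfield_chart)
qed

lemma Ck_vfield_scaleR: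
  assumes "Ck_fun A 1 \<phi>" "Ck_vfield A 1 X"
  shows "Ck_vfield A 1 (\<lambda>x. \<phi> x *\<^sub>R X x)"
proof (rule Ck_vfieldI)
  show "\<phi> x *\<^sub>R X x \<in> tangent_space A x" for x
    using assms by (intro tangent_intros Ck_vfield_tangent)
  have "Ck_on 1 (chart_image c) (\<lambda>y. \<phi> (chart_inv c y))" if "c \<in> A" for c
    using assms(1) that unfolding Ck_fun_def comp_def by blast
  then show "Ck_on 1 (chart_image c) (\<lambda>y. (\<phi> (chart_inv c y) *\<^sub>R X (chart_inv c y)) c)"
    if "c \<in> A" for c
    unfolding scaleR_fun_apply using assms(2) that by (intro Ck_on_1_scaleR Ck_vfield_chart)
qed

lemma Ck_vfield_sum:
  assumes "\<And>j. j \<in> I \<Longrightarrow> Ck_vfield A 1 (X j)"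
  shows "Ck_vfield A 1 (\<lambda>x. \<Sum>j\<in>I. X j x)"
proof -
  have z: "Ck_vfield A 1 (\<lambda>x. 0)"
    by (rule Ck_vfieldI) (auto simp: tangent_intros Ck_on_1_const simp del: One_nat_def)
  show ?thesis
    using assms by (induction I rule: infinite_finite_induct) (simp_all add: z Ck_vfield_add del: One_nat_def)
qed

lemma Ck_fun_const: "Ck_fun A 1 (\<lambda>_. a)"
  unfolding Ck_fun_def o_def using Ck_on_1_const by blast

lemma Ck_fun_affine:
  assumes "Ck_fun A 1 \<phi>"
  shows "Ck_fun A 1 (\<lambda>x. a * \<phi> x + b)"
  unfolding Ck_fun_def
proof
  fix c assume "c \<in> A"
  then have "Ck_on 1 (chart_image c) (\<lambda>y. a *\<^sub>R \<phi> (chart_inv c y) + b)"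
    using assms by (intro Ck_on_1_add Ck_on_1_scaleR Ck_on_1_const) (auto simp: Ck_fun_def o_def)
  then show "Ck_on 1 (chart_image c) ((\<lambda>x. a * \<phi> x + b) \<circ> chart_inv c)"
    by (simp add: o_def)
qed

end

section \<open>A continuously differentiable cut-off\<close>

lemma has_derivative_max_0_power2:
  "((\<lambda>t::real. (max 0 t)\<^sup>2) has_derivative (\<lambda>h. h * (2 * max 0 t))) (at t)"
proof -
  consider "t < 0" | "t > 0" | "t = 0" by linarith
  then have "((\<lambda>t::real. (max 0 t)\<^sup>2) has_real_derivative 2 * max 0 t) (at t)"
  proof cases
    case 1
    have "((\<lambda>t::real. 0) has_real_derivative 2 * max 0 t) (at t)" using 1 by simp
    then show ?thesis
      by (rule has_field_derivative_transform_within_open[of _ _ _ "{..<0}"]) (use 1 in auto)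
  next
    case 2
    have "((\<lambda>t::real. t\<^sup>2) has_real_derivative 2 * max 0 t) (at t)"
      using 2 by (auto intro!: derivative_eq_intros)
    then show ?thesis
      by (rule has_field_derivative_transform_within_open[of _ _ _ "{0<..}"]) (use 2 in auto)
  next
    \<comment> \<open>At the kink the difference quotient is bounded by
      \<open>\<bar>h\<bar>\<close>.\<close>
    case 3
    have "(\<lambda>h::real. ((max 0 (0 + h))\<^sup>2 - (max 0 0)\<^sup>2) / h) \<midarrow>0\<rightarrow> 0"
    proof (rule Lim_null_comparison)
      show "\<forall>\<^sub>F h::real in at 0. norm (((max 0 (0 + h))\<^sup>2 - (max 0 0)\<^sup>2) / h) \<le> \<bar>h\<bar>"
        by (intro always_eventually allI) (simp add: max_def power2_eq_square)
      show "(\<lambda>h::real. \<bar>h\<bar>) \<midarrow>0\<rightarrow> 0" by (rule tendsto_rabs_zero[OF tendsto_ident_at])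
    qed
    then show ?thesis using 3 by (simp add: DERIV_def)
  qed
  then show ?thesis
    unfolding has_field_derivative_def mult.commute[of "2 * max 0 t"] .
qed

text \<open>Squaring the positive part makes the derivative vanish continuously at the sphere of
  radius \<open>s\<close>.\<close>

definition bump :: "'e::euclidean_space \<Rightarrow> real \<Rightarrow> 'e \<Rightarrow> real" where
  "bump p s y = (max 0 (s\<^sup>2 - (y - p) \<bullet> (y - p)))\<^sup>2"

lemma bump_C1: "Ck_on 1 S (bump p s)"
proof (rule Ck_on_1I)
  let ?q = "\<lambda>y. s\<^sup>2 - (y - p) \<bullet> (y - p)"
  have "(?q has_derivative (\<lambda>h. 0 - ((y - p) \<bullet> (h - 0) + (h - 0) \<bullet> (y - p)))) (at y)" for y
    by (intro has_derivative_diff has_derivative_inner has_derivative_const has_derivative_ident)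
  then show "(bump p s has_derivative
      (\<lambda>h. (0 - ((y - p) \<bullet> (h - 0) + (h - 0) \<bullet> (y - p))) * (2 * max 0 (?q y)))) (at y)" for y
    using has_derivative_compose[OF _ has_derivative_max_0_power2, of ?q _ y UNIV]
    unfolding bump_def by blast
  show "continuous_on S (\<lambda>y. (0 - ((y - p) \<bullet> (v - 0) + (v - 0) \<bullet> (y - p))) * (2 * max 0 (?q y)))" for v
    by (intro continuous_intros)
qed

lemma bump_center_pos: "s \<noteq> 0 \<Longrightarrow> bump p s p > 0"
  by (simp add: bump_def)

lemma bump_support:
  assumes "s > 0" "y \<notin> cball p s"
  shows "bump p s y = 0"
proof -
  have "s\<^sup>2 \<le> (norm (y - p))\<^sup>2"
    using assms by (intro power_mono) (auto simp: dist_norm norm_minus_commute)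
  then show ?thesis by (simp add: bump_def power2_norm_eq_inner)
qed

context manifold
begin

text \<open>
  The connection acts on globally defined fields only, hence the cut-off. It need not be smooth:
  continuously differentiable fields are all that is differentiated below.
\<close>

lemma cutoff_exists:
  assumes c: "c \<in> A" and p: "p \<in> fst c"
  obtains \<theta> where "\<forall>u. Ck_vfield A 1 (\<lambda>x. \<theta> x *\<^sub>R lift_vec A c x u)"
    and "continuous_on (fst c) \<theta>" and "\<theta> p > (0::real)"
proof -
  obtain s where s: "s > 0" "cball (snd c p) s \<subseteq> chart_image c"
    using open_chart_image[OF c] chart_in[OF p] open_contains_cball by blast
  define \<beta> where "\<beta> = bump (snd c p) s"
  define \<theta> where "\<theta> x = (if x \<in> fst c then \<beta> (snd c x) else 0)" for x
  \<comment> \<open>Compact, hence closed in the Hausdorff space, and contained in the chart domain.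
    Thus \<open>fst c\<close> and \<open>- K\<close> are open and cover the manifold, and the field
    is regular on each of them.\<close>
  define K where "K = chart_inv c ` cball (snd c p) s"
  have "compact K"
    unfolding K_def
    by (rule compact_continuous_image[OF continuous_on_subset[OF continuous_on_chart_inv[OF c] s(2)]
          compact_cball])
  then have "open (- K)" using compact_imp_closed by blast
  have off: "\<theta> x = 0" if "x \<notin> K" for x
  proof (cases "x \<in> fst c")
    case True
    have "snd c x \<notin> cball (snd c p) s"
      using that chart_inv_chart[OF c True] unfolding K_def by force
    from bump_support[OF s(1) this] show ?thesis by (simp add: \<theta>_def \<beta>_def)
  qed (simp add: \<theta>_def)
  have C1: "Ck_vfield A 1 (\<lambda>x. \<theta> x *\<^sub>R lift_vec A c x u)" for u
  proof (rule Ck_vfieldI)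
    show "\<theta> x *\<^sub>R lift_vec A c x u \<in> tangent_space A x" for x
    proof (cases "x \<in> fst c")
      case True
      then show ?thesis using c by (intro tangent_intros lift_vec_in_tangent_space)
    next
      case False
      then show ?thesis by (simp add: \<theta>_def tangent_intros)
    qed
    fix d assume d: "d \<in> A"
    show "Ck_on 1 (chart_image d) (\<lambda>y. (\<theta> (chart_inv d y) *\<^sub>R lift_vec A c (chart_inv d y) u) d)"
    proof (rule Ck_on_1_local)
      fix y assume y: "y \<in> chart_image d"
      let ?x = "chart_inv d y"
      have dx: "?x \<in> fst d" "snd d ?x = y" using chart_inv_in[OF d y] chart_chart_inv[OF d y] .
      show "\<exists>U. open U \<and> y \<in> U \<and>
          Ck_on 1 U (\<lambda>y. (\<theta> (chart_inv d y) *\<^sub>R lift_vec A c (chart_inv d y) u) d)"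
      proof (cases "?x \<in> fst c")
        case True
        let ?U = "snd d ` (fst d \<inter> fst c)"
        let ?V = "snd c ` (fst c \<inter> fst d)"
        have U: "open ?U" by (rule open_chart_overlap[OF d open_chart_domain[OF c]])
        have tr: "Ck_on 1 ?U (transition d c)" using transition_Ck[OF d c] .
        have im: "transition d c ` ?U \<subseteq> ?V" using chart_inv_chart[OF d] by auto
        have 1: "Ck_on 1 ?U (\<beta> \<circ> transition d c)"
          unfolding \<beta>_def by (rule Ck_on_1_compose[OF tr bump_C1[of UNIV]]) simp
        \<comment> \<open>The representation in \<open>d\<close> is a Jacobian of the transition
          applied to \<open>u\<close>; one order of differentiability is spent on it, so the
          transition is used with order 2.\<close>
        have "Ck_on 1 ?V (\<lambda>y. frechet_derivative (transition c d) (at y) u)"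
          by (rule Ck_on_2_derivative[OF transition_Ck[OF c d]])
        from Ck_on_1_compose[OF tr this im]
        have 2: "Ck_on 1 ?U ((\<lambda>y. frechet_derivative (transition c d) (at y) u) \<circ> transition d c)" .
        have "Ck_on 1 ?U (\<lambda>y. (\<theta> (chart_inv d y) *\<^sub>R lift_vec A c (chart_inv d y) u) d)"
        proof (rule Ck_on_1_cong[OF U Ck_on_1_scaleR[OF 1 2]])
          fix y assume "y \<in> ?U"
          then have "chart_inv d y \<in> fst d \<inter> fst c" using chart_inv_chart[OF d] by auto
          then show "(\<beta> \<circ> transition d c) y *\<^sub>R
              ((\<lambda>y. frechet_derivative (transition c d) (at y) u) \<circ> transition d c) y
              = (\<theta> (chart_inv d y) *\<^sub>R lift_vec A c (chart_inv d y) u) d"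
            using d by (simp add: scaleR_fun_apply \<theta>_def lift_vec_apply)
        qed
        moreover have "y \<in> ?U" using dx True by (metis IntI imageI)
        ultimately show ?thesis using U by blast
      next
        case False
        let ?U = "snd d ` (fst d \<inter> - K)"
        have U: "open ?U" by (rule open_chart_overlap[OF d \<open>open (- K)\<close>])
        have "K \<subseteq> fst c" unfolding K_def using chart_inv_in[OF c] s(2) by blast
        \<comment> \<open>A point outside the chart domain is outside \<open>K\<close>, and on all
          of \<open>- K\<close> the factor \<open>\<theta>\<close> is 0, whatever the padded values
          of \<open>lift_vec\<close> are.\<close>
        then have "y \<in> ?U" using dx False by (metis ComplI IntI imageI subsetD)
        moreover have "Ck_on 1 ?U (\<lambda>y. (\<theta> (chart_inv d y) *\<^sub>R lift_vec A c (chart_inv d y) u) d)"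
        proof (rule Ck_on_1_cong[OF U Ck_on_1_const])
          fix y assume "y \<in> ?U"
          then have "chart_inv d y \<notin> K" using chart_inv_chart[OF d] by auto
          then show "0 = (\<theta> (chart_inv d y) *\<^sub>R lift_vec A c (chart_inv d y) u) d"
            by (simp add: scaleR_fun_apply off)
        qed
        ultimately show ?thesis using U by blast
      qed
    qed
  qed
  have cont: "continuous_on (fst c) \<theta>"
  proof -
    have "continuous_on (fst c) (\<lambda>x. \<beta> (snd c x))"
      unfolding \<beta>_def
      by (rule continuous_on_compose2[OF Ck_on_1_continuous[OF bump_C1[of UNIV]] continuous_on_chart[OF c]])
        simp
    then show ?thesis by (rule continuous_on_eq) (simp add: \<theta>_def)
  qed
  have "\<theta> p > 0" using p s(1) by (simp add: \<theta>_def \<beta>_def bump_center_pos)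
  then show ?thesis by (rule that[OF allI[OF C1] cont])
qed

end

section \<open>Metric, gradient and Hessian\<close>

locale riemannian_manifold = manifold A
  for A :: "('a::{t2_space, second_countable_topology}, 'e::euclidean_space) chart set" +
  fixes g :: "('a, 'e) metric"
  assumes metric: "riemannian_metric A g"
begin

abbreviation gchart :: "('a, 'e) chart \<Rightarrow> 'a \<Rightarrow> 'e \<Rightarrow> 'e \<Rightarrow> real" where
  "gchart c x a b \<equiv> g x (lift_vec A c x a) (lift_vec A c x b)"

lemma g_sym: "u \<in> tangent_space A x \<Longrightarrow> v \<in> tangent_space A x \<Longrightarrow> g x u v = g x v u"
  using metric unfolding riemannian_metric_def by blast

lemma g_lin: "u \<in> tangent_space A x \<Longrightarrow> v \<in> tangent_space A x \<Longrightarrow> w \<in> tangent_space A x \<Longrightarrow>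
    g x (a *\<^sub>R u + b *\<^sub>R v) w = a * g x u w + b * g x v w"
  using metric unfolding riemannian_metric_def by blast

lemma g_pos: "u \<in> tangent_space A x \<Longrightarrow> u \<noteq> 0 \<Longrightarrow> g x u u > 0"
  using metric unfolding riemannian_metric_def by blast

lemma g_smooth: "c \<in> A \<Longrightarrow> Ck_on k (chart_image c) (\<lambda>y. gchart c (chart_inv c y) a b)"
  using metric unfolding riemannian_metric_def smooth_on_def by blast

lemma g_add_left:
  assumes "u \<in> tangent_space A x" "v \<in> tangent_space A x" "w \<in> tangent_space A x"
  shows "g x (u + v) w = g x u w + g x v w"
  using g_lin[OF assms, of 1 1] by simp

lemma g_scale_left:
  assumes "u \<in> tangent_space A x" "w \<in> tangent_space A x"
  shows "g x (a *\<^sub>R u) w = a * g x u w"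
  using g_lin[OF assms(1) assms(1) assms(2), of a 0] by simp

lemma g_zero_left: "w \<in> tangent_space A x \<Longrightarrow> g x 0 w = 0"
  using g_scale_left[of 0 x w 0] by (simp add: tangent_intros)

lemma g_diff_left:
  assumes "u \<in> tangent_space A x" "v \<in> tangent_space A x" "w \<in> tangent_space A x"
  shows "g x (u - v) w = g x u w - g x v w"
  using g_lin[OF assms, of 1 "-1"] by simp

lemma g_sum_left:
  assumes "\<And>j. j \<in> I \<Longrightarrow> u j \<in> tangent_space A x" "w \<in> tangent_space A x"
  shows "g x (\<Sum>j\<in>I. u j) w = (\<Sum>j\<in>I. g x (u j) w)"
  using assms
  by (induction I rule: infinite_finite_induct) (simp_all add: g_zero_left g_add_left tangent_intros)

lemma g_add_right:
  assumes "u \<in> tangent_space A x" "v \<in> tangent_space A x" "w \<in> tangent_space A x"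
  shows "g x w (u + v) = g x w u + g x w v"
  using g_add_left[OF assms] g_sym assms tangent_intros(2) by metis

lemma g_scale_right:
  assumes "u \<in> tangent_space A x" "w \<in> tangent_space A x"
  shows "g x w (a *\<^sub>R u) = a * g x w u"
  using g_scale_left[OF assms] g_sym assms tangent_intros(4) by metis

lemma g_lin_right:
  assumes "u \<in> tangent_space A x" "v \<in> tangent_space A x" "w \<in> tangent_space A x"
  shows "g x w (a *\<^sub>R u + b *\<^sub>R v) = a * g x w u + b * g x w v"
  using assms by (simp add: g_add_right g_scale_right tangent_intros)

lemma g_sum_right:
  assumes "\<And>j. j \<in> I \<Longrightarrow> u j \<in> tangent_space A x" "w \<in> tangent_space A x"
  shows "g x w (\<Sum>j\<in>I. u j) = (\<Sum>j\<in>I. g x w (u j))"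
proof -
  have "g x w (\<Sum>j\<in>I. u j) = g x (\<Sum>j\<in>I. u j) w"
    using assms by (intro g_sym tangent_intros)
  also have "\<dots> = (\<Sum>j\<in>I. g x (u j) w)" by (rule g_sum_left[OF assms])
  also have "\<dots> = (\<Sum>j\<in>I. g x w (u j))" using assms by (intro sum.cong g_sym) auto
  finally show ?thesis .
qed

lemma g_eq_imp_eq:
  assumes "u \<in> tangent_space A x" "v \<in> tangent_space A x"
    and "\<And>w. w \<in> tangent_space A x \<Longrightarrow> g x u w = g x v w"
  shows "u = v"
proof (rule ccontr)
  assume "u \<noteq> v"
  have d: "u - v \<in> tangent_space A x" using assms by (intro tangent_intros)
  have "g x (u - v) (u - v) = 0" using g_diff_left[OF assms(1,2) d] assms(3)[OF d] by simp
  moreover have "g x (u - v) (u - v) > 0" using \<open>u \<noteq> v\<close> by (intro g_pos d) simp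
  ultimately show False by simp
qed

lemma g_nonneg: "u \<in> tangent_space A x \<Longrightarrow> g x u u \<ge> 0"
  using g_pos[of u x] g_zero_left[of 0 x] by (cases "u = 0") (auto simp: tangent_intros intro: less_imp_le)

lemma g_Cauchy_Schwarz:
  assumes u: "u \<in> tangent_space A x" and v: "v \<in> tangent_space A x"
  shows "\<bar>g x u v\<bar> \<le> tnorm g x u * tnorm g x v"
proof (cases "v = 0")
  case True
  then show ?thesis using g_zero_left[OF u] g_sym[OF u v] g_zero_left[of 0 x] by (simp add: tnorm_def tangent_intros)
next
  case False
  define p q r where "p = g x u u" "q = g x u v" "r = g x v v"
  have r: "r > 0" unfolding p_q_r_def using g_pos[OF v False] .
  \<comment> \<open>This is \<open>r\<close> times the component of \<open>u\<close> orthogonal to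
    \<open>v\<close>; the factor avoids a quotient.\<close>
  have w: "r *\<^sub>R u + (- q) *\<^sub>R v \<in> tangent_space A x" using u v by (intro tangent_intros)
  have "0 \<le> g x (r *\<^sub>R u + (- q) *\<^sub>R v) (r *\<^sub>R u + (- q) *\<^sub>R v)" by (rule g_nonneg[OF w])
  also have "\<dots> = r * g x u (r *\<^sub>R u + (- q) *\<^sub>R v) + (- q) * g x v (r *\<^sub>R u + (- q) *\<^sub>R v)"
    by (rule g_lin[OF u v w])
  also have "g x u (r *\<^sub>R u + (- q) *\<^sub>R v) = r * p + (- q) * q"
    unfolding p_q_r_def by (rule g_lin_right[OF u v u])
  also have "g x v (r *\<^sub>R u + (- q) *\<^sub>R v) = r * q + (- q) * r"
    unfolding p_q_r_def g_sym[OF u v] by (rule g_lin_right[OF u v v])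
  finally have "0 \<le> r * (r * p - q\<^sup>2)" by (simp add: algebra_simps power2_eq_square)
  then have "q\<^sup>2 \<le> p * r" using r by (simp add: zero_le_mult_iff mult.commute)
  then have "\<bar>q\<bar> \<le> sqrt (p * r)" using real_le_rsqrt by (metis real_sqrt_abs real_sqrt_le_iff)
  then show ?thesis by (simp add: tnorm_def p_q_r_def real_sqrt_mult)
qed

lemma bilinear_gchart:
  assumes "c \<in> A" "x \<in> fst c"
  shows "bilinear (gchart c x)"
  unfolding bilinear_def
proof (intro conjI allI linearI)
  note L = linear_lift_vec[OF assms] and T = lift_vec_in_tangent_space[OF assms]
  show "gchart c x a (b1 + b2) = gchart c x a b1 + gchart c x a b2" for a b1 b2
    using T by (simp add: linear_add[OF L] g_add_right)
  show "gchart c x (b1 + b2) a = gchart c x b1 a + gchart c x b2 a" for a b1 b2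
    using T by (simp add: linear_add[OF L] g_add_left)
  show "gchart c x a (r *\<^sub>R b) = r *\<^sub>R gchart c x a b" for a r b
    using T by (simp add: linear_scale[OF L] g_scale_right)
  show "gchart c x (r *\<^sub>R b) a = r *\<^sub>R gchart c x b a" for a r b
    using T by (simp add: linear_scale[OF L] g_scale_left)
qed

lemma gchart_pos:
  assumes "c \<in> A" "x \<in> fst c" "a \<noteq> 0"
  shows "gchart c x a a > 0"
proof (rule g_pos[OF lift_vec_in_tangent_space[OF assms(1,2)]])
  show "lift_vec A c x a \<noteq> 0"
    using lift_vec_self[OF assms(1,2), of a] assms(3) by (metis zero_fun_apply)
qed

text \<open>
  \<open>gmap\<close> sends the coordinates of a gradient to the vector of partial derivatives, so that gradients
  are as regular as solutions of a linear system with regular coefficients.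
\<close>

definition gmap :: "('a, 'e) chart \<Rightarrow> 'a \<Rightarrow> 'e \<Rightarrow> 'e" where
  "gmap c x a = (\<Sum>b\<in>Basis. gchart c x a b *\<^sub>R b)"

lemma linear_gmap:
  assumes "c \<in> A" "x \<in> fst c"
  shows "linear (gmap c x)"
  unfolding gmap_def
  by (rule linearI)
    (simp_all add: bilinear_ladd[OF bilinear_gchart[OF assms]] bilinear_lmul[OF bilinear_gchart[OF assms]]
      scaleR_left_distrib sum.distrib scaleR_sum_right)

lemma gmap_inner:
  assumes "c \<in> A" "x \<in> fst c"
  shows "gmap c x a \<bullet> b = gchart c x a b"
proof -
  have "linear (gchart c x a)" using bilinear_gchart[OF assms] unfolding bilinear_def by blast
  from linear_expand[OF this, of b] show ?thesis
    by (simp add: gmap_def inner_sum_left mult.commute inner_commute[of b])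
qed

text \<open>\<open>gmap\<close> is the Gram matrix of the metric in the chart, and it is positive
  definite.\<close>

lemma inj_gmap:
  assumes "c \<in> A" "x \<in> fst c"
  shows "inj (gmap c x)"
  unfolding linear_injective_0[OF linear_gmap[OF assms]]
proof (intro allI impI)
  fix a assume "gmap c x a = 0"
  then have "gchart c x a a = 0" using gmap_inner[OF assms, of a a] by simp
  then show "a = 0" using gchart_pos[OF assms, of a] by fastforce
qed

lemma grad_eqI:
  assumes "w \<in> tangent_space A x" "\<And>v. v \<in> tangent_space A x \<Longrightarrow> g x w v = dir_deriv A x v \<phi>"
  shows "grad A g \<phi> x = w"
  unfolding grad_def
proof (rule the_equality)
  show "w \<in> tangent_space A x \<and> (\<forall>v\<in>tangent_space A x. g x w v = dir_deriv A x v \<phi>)"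
    using assms by blast
  show "w' = w" if "w' \<in> tangent_space A x \<and> (\<forall>v\<in>tangent_space A x. g x w' v = dir_deriv A x v \<phi>)" for w'
    using that assms by (intro g_eq_imp_eq) auto
qed

text \<open>Existence of the gradient is Riesz representation in coordinates: the injective linear
  map \<open>gmap c x\<close> is onto, so the vector of partial derivatives has a preimage.\<close>

lemma
  assumes \<phi>: "Ck_fun A 1 \<phi>"
  shows grad_tangent: "grad A g \<phi> x \<in> tangent_space A x"
    and g_grad: "v \<in> tangent_space A x \<Longrightarrow> g x (grad A g \<phi> x) v = dir_deriv A x v \<phi>"
proof -
  obtain c where c: "c \<in> A" "x \<in> fst c" by (rule chart_exists)
  have D: "linear (dchart c \<phi> x)" using Ck_fun_has_derivative[OF \<phi> c] has_derivative_linear by blast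
  obtain a where a: "gmap c x a = (\<Sum>b\<in>Basis. dchart c \<phi> x b *\<^sub>R b)"
    using linear_injective_imp_surjective[OF linear_gmap[OF c] inj_gmap[OF c]] by (metis surjD)
  let ?w = "lift_vec A c x a"
  have w: "?w \<in> tangent_space A x" using lift_vec_in_tangent_space[OF c] .
  have eq: "g x ?w v = dir_deriv A x v \<phi>" if v: "v \<in> tangent_space A x" for v
  proof -
    have "g x ?w v = gmap c x a \<bullet> v c"
      unfolding gmap_inner[OF c] lift_vec_of_tangent[OF v c] ..
    also have "\<dots> = dchart c \<phi> x (v c)"
      using linear_expand[OF D, of "v c"]
      by (simp add: a inner_sum_left mult.commute inner_commute[of "v c"])
    finally show ?thesis using dir_deriv_chart[OF \<phi> c v] by simp
  qed
  have "grad A g \<phi> x = ?w" using w eq by (rule grad_eqI)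
  then show "grad A g \<phi> x \<in> tangent_space A x"
    and "v \<in> tangent_space A x \<Longrightarrow> g x (grad A g \<phi> x) v = dir_deriv A x v \<phi>"
    using w eq by simp_all
qed

text \<open>In a chart the gradient solves the system with matrix \<open>gmap\<close> and the
  partial derivatives of \<open>\<phi>\<close> as right-hand side; both are continuously
  differentiable.\<close>

lemma grad_C1:
  assumes \<phi>: "Ck_fun A 2 \<phi>"
  shows "Ck_vfield A 1 (grad A g \<phi>)"
proof (rule Ck_vfieldI)
  note \<phi>1 = Ck_fun_2_imp_1[OF \<phi>]
  show "grad A g \<phi> x \<in> tangent_space A x" for x by (rule grad_tangent[OF \<phi>1])
  fix c assume c: "c \<in> A"
  show "Ck_on 1 (chart_image c) (\<lambda>y. grad A g \<phi> (chart_inv c y) c)"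
  proof (rule Ck_on_1_linear_solution[OF open_chart_image[OF c]])
    show "linear (gmap c (chart_inv c y))" "inj (gmap c (chart_inv c y))" if "y \<in> chart_image c" for y
      using linear_gmap[OF c] inj_gmap[OF c] chart_inv_in[OF c that] by blast+
    show "Ck_on 1 (chart_image c) (\<lambda>y. gmap c (chart_inv c y) a)" for a
      unfolding gmap_def by (intro Ck_on_1_sum Ck_on_1_scaleR Ck_on_1_const g_smooth c)
    show "Ck_on 1 (chart_image c)
        (\<lambda>y. \<Sum>b\<in>Basis. frechet_derivative (\<phi> \<circ> chart_inv c) (at y) b *\<^sub>R b)"
      using \<phi> c unfolding Ck_fun_def
      by (intro Ck_on_1_sum Ck_on_1_scaleR Ck_on_1_const Ck_on_2_derivative) blast
    fix y assume y: "y \<in> chart_image c"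
    let ?x = "chart_inv c y"
    have x: "?x \<in> fst c" "snd c ?x = y" using chart_inv_in[OF c y] chart_chart_inv[OF c y] .
    have "gchart c ?x (grad A g \<phi> ?x c) b = frechet_derivative (\<phi> \<circ> chart_inv c) (at y) b" for b
      using g_grad[OF \<phi>1 lift_vec_in_tangent_space[OF c x(1)], of b]
        dir_deriv_chart[OF \<phi>1 c x(1) lift_vec_in_tangent_space[OF c x(1)], of b]
        lift_vec_of_tangent[OF grad_tangent[OF \<phi>1] c x(1)] c x
      by simp
    then show "gmap c ?x (grad A g \<phi> ?x c)
        = (\<Sum>b\<in>Basis. frechet_derivative (\<phi> \<circ> chart_inv c) (at y) b *\<^sub>R b)"
      unfolding gmap_def by simp
  qed
qed

end

section \<open>The Riemannian connection and the Hessian\<close>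

locale riemannian_manifold_connection = riemannian_manifold A g
  for A :: "('a::{t2_space, second_countable_topology}, 'e::euclidean_space) chart set"
    and g :: "('a, 'e) metric" +
  fixes nabla :: "'a \<Rightarrow> ('a, 'e) tvec \<Rightarrow> ('a, 'e) vfield \<Rightarrow> ('a, 'e) tvec"
  assumes connection: "riemannian_connection A g nabla"
begin

lemma affine: "affine_connection A nabla"
  using connection unfolding riemannian_connection_def by blast

text \<open>The order 0 case of the regularity axiom. It is the source of continuity of
  \<open>nabla\<close> as the base point moves.\<close>

lemma nabla_continuous:
  assumes "Ck_vfield A 0 X" "Ck_vfield A 1 Y"
  shows "Ck_vfield A 0 (\<lambda>x. nabla x (X x) Y)"
proof -
  have "\<forall>k X Y. Ck_vfield A k X \<longrightarrow> Ck_vfield A (Suc k) Y \<longrightarrow>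
      Ck_vfield A k (\<lambda>x. nabla x (X x) Y)"
    using affine unfolding affine_connection_def by (rule conjunct1)
  from this[rule_format, OF assms(1) assms(2)[unfolded One_nat_def]] show ?thesis .
qed

lemma nabla_tangent:
  assumes "Ck_vfield A 1 Y" "u \<in> tangent_space A x"
  shows "nabla x u Y \<in> tangent_space A x"
  using affine assms unfolding affine_connection_def by blast

lemma nabla_linear_direction:
  assumes "Ck_vfield A 1 Y" "u \<in> tangent_space A x" "v \<in> tangent_space A x"
  shows "nabla x (a *\<^sub>R u + b *\<^sub>R v) Y = a *\<^sub>R nabla x u Y + b *\<^sub>R nabla x v Y"
  using affine assms unfolding affine_connection_def by blast

lemma nabla_linear_field:
  assumes "Ck_vfield A 1 Y" "Ck_vfield A 1 Z" "u \<in> tangent_space A x"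
  shows "nabla x u (\<lambda>p. a *\<^sub>R Y p + b *\<^sub>R Z p) = a *\<^sub>R nabla x u Y + b *\<^sub>R nabla x u Z"
  using affine assms unfolding affine_connection_def by blast

lemma nabla_Leibniz:
  assumes "Ck_fun A 1 \<phi>" "Ck_vfield A 1 Y" "u \<in> tangent_space A x"
  shows "nabla x u (\<lambda>p. \<phi> p *\<^sub>R Y p) = dir_deriv A x u \<phi> *\<^sub>R Y x + \<phi> x *\<^sub>R nabla x u Y"
  using affine assms unfolding affine_connection_def by blast

lemma nabla_torsion_free:
  assumes "Ck_vfield A 1 X" "Ck_vfield A 1 Y" "Ck_fun A 2 \<phi>"
  shows "dir_deriv A x (nabla x (X x) Y - nabla x (Y x) X) \<phi> =
        dir_deriv A x (X x) (\<lambda>p. dir_deriv A p (Y p) \<phi>) -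
        dir_deriv A x (Y x) (\<lambda>p. dir_deriv A p (X p) \<phi>)"
  using connection assms unfolding riemannian_connection_def by blast

lemma nabla_metric:
  assumes "Ck_vfield A 1 Y" "Ck_vfield A 1 Z" "u \<in> tangent_space A x"
  shows "dir_deriv A x u (\<lambda>p. g p (Y p) (Z p)) =
        g x (nabla x u Y) (Z x) + g x (Y x) (nabla x u Z)"
  using connection assms unfolding riemannian_connection_def by blast

lemma nabla_scale_direction:
  assumes "Ck_vfield A 1 Y" "u \<in> tangent_space A x"
  shows "nabla x (a *\<^sub>R u) Y = a *\<^sub>R nabla x u Y"
  using nabla_linear_direction[OF assms assms(2), of a 0] by simp

lemma nabla_add_direction:
  assumes "Ck_vfield A 1 Y" "u \<in> tangent_space A x" "v \<in> tangent_space A x"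
  shows "nabla x (u + v) Y = nabla x u Y + nabla x v Y"
  using nabla_linear_direction[OF assms, of 1 1] by simp

lemma nabla_add_field:
  assumes "Ck_vfield A 1 Y" "Ck_vfield A 1 Z" "u \<in> tangent_space A x"
  shows "nabla x u (\<lambda>p. Y p + Z p) = nabla x u Y + nabla x u Z"
  using nabla_linear_field[OF assms, of 1 1] by simp

lemma Ck_vfield_zero: "Ck_vfield A 1 (\<lambda>_. 0)"
  using Ck_vfield_sum[of "{}"] by simp

lemma nabla_sum_field:
  assumes "\<And>j. j \<in> I \<Longrightarrow> Ck_vfield A 1 (Y j)" "u \<in> tangent_space A x"
  shows "nabla x u (\<lambda>p. \<Sum>j\<in>I. Y j p) = (\<Sum>j\<in>I. nabla x u (Y j))"
proof -
  have z: "nabla x u (\<lambda>_. 0) = 0"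
    using nabla_linear_field[OF Ck_vfield_zero Ck_vfield_zero assms(2), of 0 0] by simp
  show ?thesis
    using assms(1)
  proof (induction I rule: infinite_finite_induct)
    case (insert j I)
    have "nabla x u (\<lambda>p. Y j p + (\<Sum>i\<in>I. Y i p)) = nabla x u (Y j) + nabla x u (\<lambda>p. \<Sum>i\<in>I. Y i p)"
      using insert.prems assms(2) by (intro nabla_add_field Ck_vfield_sum) auto
    moreover have "nabla x u (\<lambda>p. \<Sum>i\<in>I. Y i p) = (\<Sum>i\<in>I. nabla x u (Y i))"
      by (rule insert.IH[OF insert.prems[OF insertI2]])
    ultimately show ?case by (simp only: sum.insert[OF insert.hyps])
  qed (simp_all add: z)
qed

text \<open>A cut-off coordinate field with constant coordinates \<open>v c\<close>, divided by the
  value of the cut-off at \<open>x\<close>.\<close>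

lemma vector_field_extension:
  assumes "v \<in> tangent_space A x"
  obtains X where "Ck_vfield A 1 X" "X x = v"
proof -
  obtain c where c: "c \<in> A" "x \<in> fst c" by (rule chart_exists)
  obtain \<theta> where \<theta>: "\<forall>u. Ck_vfield A 1 (\<lambda>x. \<theta> x *\<^sub>R lift_vec A c x u)"
      and "continuous_on (fst c) \<theta>" and "\<theta> x > (0::real)"
    by (rule cutoff_exists[OF c])
  have "\<theta> x *\<^sub>R lift_vec A c x (v c /\<^sub>R \<theta> x) = v"
    using \<open>\<theta> x > 0\<close> lift_vec_of_tangent[OF assms c]
    by (simp add: linear_scale[OF linear_lift_vec[OF c]])
  with \<theta>[rule_format] show ?thesis by (rule that)
qed

lemma Hess_tangent:
  assumes "Ck_fun A 2 \<phi>" "v \<in> tangent_space A x"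
  shows "Hess A g nabla \<phi> x v \<in> tangent_space A x"
  unfolding Hess_def by (rule nabla_tangent[OF grad_C1[OF assms(1)] assms(2)])

text \<open>
  Extend \<open>u\<close> and \<open>v\<close> to fields \<open>U\<close> and \<open>V\<close>. Metric compatibility turns the Hessian form into
  \<open>U (V \<phi>) - (\<nabla>\<^sub>U V) \<phi>\<close>, which is symmetric in \<open>U\<close> and \<open>V\<close> because the torsion vanishes; no symmetry
  of second partial derivatives is needed.
\<close>

lemma Hess_symmetric:
  assumes \<phi>: "Ck_fun A 2 \<phi>" and u: "u \<in> tangent_space A x" and v: "v \<in> tangent_space A x"
  shows "g x (Hess A g nabla \<phi> x u) v = g x (Hess A g nabla \<phi> x v) u"
proof -
  obtain U where U: "Ck_vfield A 1 U" "U x = u" by (rule vector_field_extension[OF u])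
  obtain V where V: "Ck_vfield A 1 V" "V x = v" by (rule vector_field_extension[OF v])
  let ?G = "grad A g \<phi>"
  note G = grad_C1[OF \<phi>] and \<phi>1 = Ck_fun_2_imp_1[OF \<phi>]
  have gG: "g p (?G p) (W p) = dir_deriv A p (W p) \<phi>" if "Ck_vfield A 1 W" for p W
    by (rule g_grad[OF \<phi>1 Ck_vfield_tangent[OF that]])
  have tUV: "nabla x u V \<in> tangent_space A x" "nabla x v U \<in> tangent_space A x"
    using nabla_tangent U V u v by auto
  have 1: "dir_deriv A x u (\<lambda>p. dir_deriv A p (V p) \<phi>)
      = g x (nabla x u ?G) v + g x (?G x) (nabla x u V)"
    using nabla_metric[OF G V(1) u] gG[OF V(1)] V(2) by simp
  have 2: "dir_deriv A x v (\<lambda>p. dir_deriv A p (U p) \<phi>)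
      = g x (nabla x v ?G) u + g x (?G x) (nabla x v U)"
    using nabla_metric[OF G U(1) v] gG[OF U(1)] U(2) by simp
  \<comment> \<open>Pairing with the gradient is differentiation of \<open>\<phi>\<close>, so the
    torsion identity has to be tested only on \<open>\<phi>\<close> itself.\<close>
  have "g x (?G x) (nabla x u V - nabla x v U) = dir_deriv A x (nabla x u V - nabla x v U) \<phi>"
    by (rule g_grad[OF \<phi>1]) (intro tangent_intros tUV)
  moreover have "g x (?G x) (nabla x u V - nabla x v U) = g x (?G x) (nabla x u V) - g x (?G x) (nabla x v U)"
    using g_lin_right[OF tUV grad_tangent[OF \<phi>1], of 1 "-1"] by simp
  ultimately show ?thesis
    using nabla_torsion_free[OF U(1) V(1) \<phi>, of x] U(2) V(2) 1 2 unfolding Hess_def by simp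
qed

text \<open>In chart coordinates \<open>H\<close> becomes an operator on a Euclidean space that is
  self-adjoint for the metric. The least value of its Rayleigh quotient is an eigenvalue, hence at
  least \<open>m\<close>.\<close>

lemma quadratic_form_ge_of_eigenvalues_ge:
  assumes T: "\<And>v. v \<in> tangent_space A x \<Longrightarrow> H v \<in> tangent_space A x"
    and lin: "\<And>u v. u \<in> tangent_space A x \<Longrightarrow> v \<in> tangent_space A x \<Longrightarrow> H (u + v) = H u + H v"
      "\<And>a v. v \<in> tangent_space A x \<Longrightarrow> H (a *\<^sub>R v) = a *\<^sub>R H v"
    and sym: "\<And>u v. u \<in> tangent_space A x \<Longrightarrow> v \<in> tangent_space A x \<Longrightarrow> g x (H u) v = g x (H v) u"
    and ev: "\<And>\<mu>. \<mu> \<in> eigenvalues_on (tangent_space A x) H \<Longrightarrow> m \<le> \<mu>"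
    and v: "v \<in> tangent_space A x"
  shows "m * g x v v \<le> g x v (H v)"
proof -
  obtain c where c: "c \<in> A" "x \<in> fst c" by (rule chart_exists)
  note L = linear_lift_vec[OF c] and LT = lift_vec_in_tangent_space[OF c]
  define S where "S a = H (lift_vec A c x a) c" for a
  have LS: "lift_vec A c x (S a) = H (lift_vec A c x a)" for a
    unfolding S_def by (rule lift_vec_of_tangent[OF T[OF LT] c])
  have "linear S"
    unfolding S_def
    by (rule linearI) (simp_all add: linear_add[OF L] linear_scale[OF L] lin LT plus_fun_apply scaleR_fun_apply)
  moreover have "gchart c x a (S b) = gchart c x b (S a)" for a b
    unfolding LS using sym[OF LT LT, of a b] g_sym[OF LT T[OF LT]] by metis
  moreover have "gchart c x a b = gchart c x b a" for a b by (rule g_sym[OF LT LT])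
  ultimately obtain \<mu> a where a: "a \<noteq> 0" "S a = \<mu> *\<^sub>R a"
      and \<mu>: "\<And>b. \<mu> * gchart c x b b \<le> gchart c x b (S b)"
    using symmetric_least_eigenvalue[OF bilinear_gchart[OF c] _ gchart_pos[OF c], of S] by metis
  have "H (lift_vec A c x a) = \<mu> *\<^sub>R lift_vec A c x a"
    unfolding LS[symmetric] a(2) by (rule linear_scale[OF L])
  moreover have "lift_vec A c x a \<noteq> 0"
    using lift_vec_self[OF c, of a] a(1) by (metis zero_fun_apply)
  ultimately have "\<mu> \<in> eigenvalues_on (tangent_space A x) H"
    unfolding eigenvalues_on_def using LT by blast
  then have "m * g x v v \<le> \<mu> * g x v v"
    using ev g_nonneg[OF v] by (simp add: mult_right_mono)
  also have "\<dots> \<le> g x v (H v)"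
    using \<mu>[of "v c"] unfolding LS lift_vec_of_tangent[OF v c] .
  finally show ?thesis .
qed

section \<open>Limits of metric, connection and Hessian in a chart\<close>

lemma chart_tendsto:
  assumes c: "c \<in> A" and p: "p \<in> fst c" and X: "(X \<longlongrightarrow> p) F"
    and q: "continuous_on (chart_image c) (\<lambda>y. q (chart_inv c y))"
  shows "((\<lambda>i. q (X i)) \<longlongrightarrow> q p) F"
proof -
  have ev: "\<forall>\<^sub>F i in F. X i \<in> fst c"
    using topological_tendstoD[OF X open_chart_domain[OF c] p] .
  have Y: "((\<lambda>i. snd c (X i)) \<longlongrightarrow> snd c p) F"
    by (rule continuous_on_tendsto_compose[OF continuous_on_chart[OF c] X p ev])
  have "((\<lambda>i. q (chart_inv c (snd c (X i)))) \<longlongrightarrow> q (chart_inv c (snd c p))) F"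
    by (rule continuous_on_tendsto_compose[OF q Y chart_in[OF p]])
      (rule eventually_mono[OF ev chart_in])
  then have *: "((\<lambda>i. q (chart_inv c (snd c (X i)))) \<longlongrightarrow> q p) F"
    using chart_inv_chart[OF c p] by simp
  have "\<forall>\<^sub>F i in F. q (chart_inv c (snd c (X i))) = q (X i)"
    using ev by eventually_elim (simp add: chart_inv_chart[OF c])
  from Lim_transform_eventually[OF * this] show ?thesis .
qed

text \<open>Bilinearity reduces moving coordinate vectors to fixed basis vectors, for which the
  smoothness clause of the metric applies.\<close>

lemma gchart_tendsto:
  assumes c: "c \<in> A" and p: "p \<in> fst c" and X: "(X \<longlongrightarrow> p) F"
    and a: "(a \<longlongrightarrow> a0) F" and b: "(b \<longlongrightarrow> b0) F"
  shows "((\<lambda>i. gchart c (X i) (a i) (b i)) \<longlongrightarrow> gchart c p a0 b0) F"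
proof -
  let ?s = "\<lambda>x a b. (\<Sum>d\<in>Basis. (a \<bullet> d) *\<^sub>R gmap c x d) \<bullet> b"
  have eq: "?s x a b = gchart c x a b" if "x \<in> fst c" for x a b
    using linear_expand[OF linear_gmap[OF c that], of a] gmap_inner[OF c that, of a b] by simp
  have "((\<lambda>i. gmap c (X i) d) \<longlongrightarrow> gmap c p d) F" for d
    unfolding gmap_def
    by (rule chart_tendsto[OF c p X, of "\<lambda>x. \<Sum>b\<in>Basis. gchart c x d b *\<^sub>R b"])
      (intro continuous_intros g_smooth[OF c, of 0, simplified])
  then have "((\<lambda>i. ?s (X i) (a i) (b i)) \<longlongrightarrow> ?s p a0 b0) F"
    by (intro tendsto_inner tendsto_sum tendsto_scaleR a b tendsto_const)
  then have *: "((\<lambda>i. ?s (X i) (a i) (b i)) \<longlongrightarrow> gchart c p a0 b0) F" unfolding eq[OF p] .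
  have "\<forall>\<^sub>F i in F. X i \<in> fst c"
    using topological_tendstoD[OF X open_chart_domain[OF c] p] .
  then have "\<forall>\<^sub>F i in F. ?s (X i) (a i) (b i) = gchart c (X i) (a i) (b i)"
    by eventually_elim (rule eq)
  from Lim_transform_eventually[OF * this] show ?thesis .
qed

text \<open>Linearity in the direction reduces to coordinate basis directions. These become global
  fields after multiplication by \<open>\<theta>\<close>, to which the regularity axiom applies, and
  near \<open>p\<close>, where \<open>\<theta>\<close> is positive, the factor is divided out
  again.\<close>

lemma nabla_tendsto:
  assumes c: "c \<in> A" and p: "p \<in> fst c" and X: "(X \<longlongrightarrow> p) F"
    and a: "(a \<longlongrightarrow> a0) F" and Y: "Ck_vfield A 1 Y"
  shows "((\<lambda>i. nabla (X i) (lift_vec A c (X i) (a i)) Y c)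
    \<longlongrightarrow> nabla p (lift_vec A c p a0) Y c) F"
proof -
  obtain \<theta> where \<theta>: "\<forall>u. Ck_vfield A 1 (\<lambda>x. \<theta> x *\<^sub>R lift_vec A c x u)"
      and cont: "continuous_on (fst c) \<theta>" and pos: "\<theta> p > (0::real)"
    by (rule cutoff_exists[OF c p])
  let ?N = "\<lambda>x d. nabla x (\<theta> x *\<^sub>R lift_vec A c x d) Y c"
  let ?s = "\<lambda>x a. \<Sum>d\<in>Basis. (a \<bullet> d) *\<^sub>R (?N x d /\<^sub>R \<theta> x)"
  have eq: "?s x a = nabla x (lift_vec A c x a) Y c" if x: "x \<in> fst c" "\<theta> x > 0" for x a
  proof -
    note L = linear_lift_vec[OF c x(1)] and LT = lift_vec_in_tangent_space[OF c x(1)]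
    have "linear (\<lambda>a. nabla x (lift_vec A c x a) Y c)"
      by (rule linearI)
        (simp_all add: linear_add[OF L] linear_scale[OF L] nabla_add_direction[OF Y LT LT]
          nabla_scale_direction[OF Y LT] plus_fun_apply scaleR_fun_apply)
    from linear_expand[OF this, of a] show ?thesis
      using x(2) by (simp add: nabla_scale_direction[OF Y LT] scaleR_fun_apply)
  qed
  have ev: "\<forall>\<^sub>F i in F. X i \<in> fst c"
    using topological_tendstoD[OF X open_chart_domain[OF c] p] .
  have \<theta>X: "((\<lambda>i. \<theta> (X i)) \<longlongrightarrow> \<theta> p) F"
    by (rule continuous_on_tendsto_compose[OF cont X p ev])
  have "((\<lambda>i. ?N (X i) d) \<longlongrightarrow> ?N p d) F" for d
  proof (rule chart_tendsto[OF c p X])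
    have "Ck_vfield A 0 (\<lambda>x. \<theta> x *\<^sub>R lift_vec A c x d)"
      using \<theta>[rule_format, of d] unfolding Ck_vfield_def by (simp add: Ck_on_1_continuous del: One_nat_def)
    from Ck_vfield_chart[OF nabla_continuous[OF this Y] c]
    show "continuous_on (chart_image c) (\<lambda>y. ?N (chart_inv c y) d)" by simp
  qed
  then have "((\<lambda>i. ?s (X i) (a i)) \<longlongrightarrow> ?s p a0) F"
    using pos by (intro tendsto_sum tendsto_scaleR tendsto_inner a tendsto_const tendsto_inverse \<theta>X) auto
  then have *: "((\<lambda>i. ?s (X i) (a i)) \<longlongrightarrow> nabla p (lift_vec A c p a0) Y c) F"
    unfolding eq[OF p pos] .
  have "\<forall>\<^sub>F i in F. ?s (X i) (a i) = nabla (X i) (lift_vec A c (X i) (a i)) Y c"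
    using ev order_tendstoD(1)[OF \<theta>X pos] by eventually_elim (rule eq)
  from Lim_transform_eventually[OF * this] show ?thesis .
qed

text \<open>The Hessian vector is replaced by its coordinates in \<open>c\<close>, so that the
  connection and the metric pass to the limit one after the other.\<close>

lemma Hess_quadratic_form_tendsto:
  assumes c: "c \<in> A" and p: "p \<in> fst c" and X: "(X \<longlongrightarrow> p) F"
    and a: "(a \<longlongrightarrow> a0) F" and \<phi>: "Ck_fun A 2 \<phi>"
  shows "((\<lambda>i. g (X i) (lift_vec A c (X i) (a i)) (Hess A g nabla \<phi> (X i) (lift_vec A c (X i) (a i))))
    \<longlongrightarrow> g p (lift_vec A c p a0) (Hess A g nabla \<phi> p (lift_vec A c p a0))) F"
proof -
  let ?H = "\<lambda>x a. Hess A g nabla \<phi> x (lift_vec A c x a)"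
  have eq: "gchart c x a (?H x a c) = g x (lift_vec A c x a) (?H x a)" if "x \<in> fst c" for x a
    using lift_vec_of_tangent[OF Hess_tangent[OF \<phi> lift_vec_in_tangent_space[OF c that]] c that]
    by simp
  have "((\<lambda>i. ?H (X i) (a i) c) \<longlongrightarrow> ?H p a0 c) F"
    unfolding Hess_def by (rule nabla_tendsto[OF c p X a grad_C1[OF \<phi>]])
  from gchart_tendsto[OF c p X a this]
  have *: "((\<lambda>i. gchart c (X i) (a i) (?H (X i) (a i) c)) \<longlongrightarrow> g p (lift_vec A c p a0) (?H p a0)) F"
    unfolding eq[OF p] .
  have "\<forall>\<^sub>F i in F. X i \<in> fst c"
    using topological_tendstoD[OF X open_chart_domain[OF c] p] .
  then have "\<forall>\<^sub>F i in F. gchart c (X i) (a i) (?H (X i) (a i) c)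
      = g (X i) (lift_vec A c (X i) (a i)) (?H (X i) (a i))"
    by eventually_elim (rule eq)
  from Lim_transform_eventually[OF * this] show ?thesis .
qed

end

section \<open>Differentials of functions in a chart\<close>

context manifold
begin

text \<open>The Euclidean gradient in the chart. It represents the differential without the metric
  and lies in the same space for all base points, so differentials at different points can be
  compared.\<close>

definition partials :: "('a, 'e) chart \<Rightarrow> ('a \<Rightarrow> real) \<Rightarrow> 'a \<Rightarrow> 'e" where
  "partials c \<phi> x = (\<Sum>b\<in>Basis. dchart c \<phi> x b *\<^sub>R b)"

lemma partials_inner:
  assumes \<phi>: "Ck_fun A 1 \<phi>" and c: "c \<in> A" "x \<in> fst c"
  shows "partials c \<phi> x \<bullet> a = dir_deriv A x (lift_vec A c x a) \<phi>"
proof -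
  have "linear (dchart c \<phi> x)" using Ck_fun_has_derivative[OF \<phi> c] has_derivative_linear by blast
  from linear_expand[OF this, of a] have "partials c \<phi> x \<bullet> a = dchart c \<phi> x a"
    by (simp add: partials_def inner_sum_left mult.commute inner_commute[of a])
  also have "\<dots> = dir_deriv A x (lift_vec A c x a) \<phi>"
    using dir_deriv_chart[OF \<phi> c lift_vec_in_tangent_space[OF c], of a] c by simp
  finally show ?thesis .
qed

lemma continuous_on_partials:
  assumes \<phi>: "Ck_fun A 1 \<phi>" and c: "c \<in> A"
  shows "continuous_on (chart_image c) (\<lambda>y. partials c \<phi> (chart_inv c y))"
proof -
  have "Ck_on 1 (chart_image c) (\<phi> \<circ> chart_inv c)" using \<phi> c unfolding Ck_fun_def by blast
  then have "continuous_on (chart_image c)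
      (\<lambda>y. \<Sum>b\<in>Basis. frechet_derivative (\<phi> \<circ> chart_inv c) (at y) b *\<^sub>R b)"
    by (intro continuous_on_sum continuous_on_scaleR continuous_on_const Ck_on_1_derivative_continuous)
  then show ?thesis
    by (rule continuous_on_eq) (simp add: partials_def chart_chart_inv[OF c])
qed

end

section \<open>Lagrangians\<close>

locale equality_constrained_problem = riemannian_manifold_connection A g nabla
  for A :: "('a::{t2_space, second_countable_topology}, 'e::euclidean_space) chart set"
    and g :: "('a, 'e) metric"
    and nabla :: "'a \<Rightarrow> ('a, 'e) tvec \<Rightarrow> ('a, 'e) vfield \<Rightarrow> ('a, 'e) tvec" +
  fixes E :: "'j set" and f :: "'a \<Rightarrow> real" and h :: "'j \<Rightarrow> 'a \<Rightarrow> real"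
  assumes finite_E: "finite E" and f_C2: "Ck_fun A 2 f"
    and h_C2: "\<And>j. j \<in> E \<Longrightarrow> Ck_fun A 2 (h j)"
begin

lemmas f_C1 = Ck_fun_2_imp_1[OF f_C2]

lemma h_C1: "j \<in> E \<Longrightarrow> Ck_fun A 1 (h j)"
  by (rule Ck_fun_2_imp_1[OF h_C2])

text \<open>The coefficients are frozen at the point \<open>x\<close>, so the lemma covers the
  augmented Lagrangian, whose effective multipliers vary with the point.\<close>

lemma grad_combination:
  assumes "\<And>v. v \<in> tangent_space A x \<Longrightarrow>
    dir_deriv A x v \<phi> = dir_deriv A x v f + (\<Sum>j\<in>E. m j * dir_deriv A x v (h j))"
  shows "grad A g \<phi> x = grad A g f x + (\<Sum>j\<in>E. m j *\<^sub>R grad A g (h j) x)"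
proof (rule grad_eqI)
  have S: "m j *\<^sub>R grad A g (h j) x \<in> tangent_space A x" if "j \<in> E" for j
    by (intro tangent_intros grad_tangent h_C1 that)
  show "grad A g f x + (\<Sum>j\<in>E. m j *\<^sub>R grad A g (h j) x) \<in> tangent_space A x"
    by (intro tangent_intros(2,5) grad_tangent f_C1 S)
  fix v assume v: "v \<in> tangent_space A x"
  have "g x (grad A g f x + (\<Sum>j\<in>E. m j *\<^sub>R grad A g (h j) x)) v
      = g x (grad A g f x) v + g x (\<Sum>j\<in>E. m j *\<^sub>R grad A g (h j) x) v"
    by (intro g_add_left tangent_intros(5) grad_tangent f_C1 S v)
  also have "g x (\<Sum>j\<in>E. m j *\<^sub>R grad A g (h j) x) v = (\<Sum>j\<in>E. g x (m j *\<^sub>R grad A g (h j) x) v)"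
    by (intro g_sum_left S v)
  also have "\<dots> = (\<Sum>j\<in>E. m j * dir_deriv A x v (h j))"
    by (intro sum.cong refl) (simp only: g_scale_left[OF grad_tangent[OF h_C1] v] g_grad[OF h_C1 v])
  finally show "g x (grad A g f x + (\<Sum>j\<in>E. m j *\<^sub>R grad A g (h j) x)) v = dir_deriv A x v \<phi>"
    unfolding assms[OF v] g_grad[OF f_C1 v] .
qed

text \<open>For multipliers that vary with the point the Leibniz rule adds multiples of the
  constraint gradients. Constant multipliers give the Lagrangian; \<open>r * h j p + m j\<close>
  gives the augmented one and the rank-one terms.\<close>

lemma nabla_combination:
  assumes m: "\<And>j. j \<in> E \<Longrightarrow> Ck_fun A 1 (m j)"
  shows Ck_combination: "Ck_vfield A 1 (\<lambda>p. grad A g f p + (\<Sum>j\<in>E. m j p *\<^sub>R grad A g (h j) p))"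
    and "v \<in> tangent_space A x \<Longrightarrow>
      nabla x v (\<lambda>p. grad A g f p + (\<Sum>j\<in>E. m j p *\<^sub>R grad A g (h j) p))
      = Hess A g nabla f x v + (\<Sum>j\<in>E. dir_deriv A x v (m j) *\<^sub>R grad A g (h j) x
          + m j x *\<^sub>R Hess A g nabla (h j) x v)"
proof -
  have S: "Ck_vfield A 1 (\<lambda>p. m j p *\<^sub>R grad A g (h j) p)" if "j \<in> E" for j
    by (intro Ck_vfield_scaleR grad_C1 h_C2 m that)
  show "Ck_vfield A 1 (\<lambda>p. grad A g f p + (\<Sum>j\<in>E. m j p *\<^sub>R grad A g (h j) p))"
    by (intro Ck_vfield_add Ck_vfield_sum grad_C1 f_C2 S)
  assume v: "v \<in> tangent_space A x"
  have "nabla x v (\<lambda>p. grad A g f p + (\<Sum>j\<in>E. m j p *\<^sub>R grad A g (h j) p))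
      = nabla x v (grad A g f) + nabla x v (\<lambda>p. \<Sum>j\<in>E. m j p *\<^sub>R grad A g (h j) p)"
    by (intro nabla_add_field Ck_vfield_sum grad_C1 f_C2 S v)
  also have "nabla x v (\<lambda>p. \<Sum>j\<in>E. m j p *\<^sub>R grad A g (h j) p)
      = (\<Sum>j\<in>E. nabla x v (\<lambda>p. m j p *\<^sub>R grad A g (h j) p))"
    by (intro nabla_sum_field S v)
  also have "\<dots> = (\<Sum>j\<in>E. dir_deriv A x v (m j) *\<^sub>R grad A g (h j) x
          + m j x *\<^sub>R nabla x v (grad A g (h j)))"
    by (intro sum.cong refl nabla_Leibniz grad_C1 h_C2 m v)
  finally show "nabla x v (\<lambda>p. grad A g f p + (\<Sum>j\<in>E. m j p *\<^sub>R grad A g (h j) p))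
      = Hess A g nabla f x v + (\<Sum>j\<in>E. dir_deriv A x v (m j) *\<^sub>R grad A g (h j) x
          + m j x *\<^sub>R Hess A g nabla (h j) x v)"
    unfolding Hess_def .
qed

lemma dir_deriv_const: "v \<in> tangent_space A x \<Longrightarrow> dir_deriv A x v (\<lambda>_. a) = 0"
proof -
  assume v: "v \<in> tangent_space A x"
  obtain c where c: "c \<in> A" "x \<in> fst c" by (rule chart_exists)
  show ?thesis
    by (rule dir_deriv_eq[OF c v]) (simp add: o_def)
qed

lemma dir_deriv_affine:
  assumes "Ck_fun A 1 \<phi>" and v: "v \<in> tangent_space A x"
  shows "dir_deriv A x v (\<lambda>p. a * \<phi> p + b) = a * dir_deriv A x v \<phi>"
proof -
  obtain c where c: "c \<in> A" "x \<in> fst c" by (rule chart_exists)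
  have "((\<lambda>p. a * \<phi> p + b) \<circ> chart_inv c has_derivative (\<lambda>u. a * dchart c \<phi> x u)) (at (snd c x))"
    using has_derivative_add[OF has_derivative_mult_right[OF Ck_fun_has_derivative[OF assms(1) c], of a]
        has_derivative_const[of b]]
    by (simp add: o_def)
  from dir_deriv_eq[OF c v this] show ?thesis using dir_deriv_chart[OF assms(1) c v] by simp
qed

lemma dir_deriv_lagrangian:
  assumes v: "v \<in> tangent_space A x"
  shows "dir_deriv A x v (lagrangian f E h m)
    = dir_deriv A x v f + (\<Sum>j\<in>E. m j * dir_deriv A x v (h j))"
proof -
  obtain c where c: "c \<in> A" "x \<in> fst c" by (rule chart_exists)
  have "((\<lambda>y. (f \<circ> chart_inv c) y + (\<Sum>j\<in>E. m j * (h j \<circ> chart_inv c) y)) has_derivative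
      (\<lambda>u. dchart c f x u + (\<Sum>j\<in>E. m j * dchart c (h j) x u))) (at (snd c x))"
    by (intro has_derivative_add has_derivative_sum has_derivative_mult_right
        Ck_fun_has_derivative f_C1 h_C1 c)
  then have "(lagrangian f E h m \<circ> chart_inv c has_derivative
      (\<lambda>u. dchart c f x u + (\<Sum>j\<in>E. m j * dchart c (h j) x u))) (at (snd c x))"
    by (simp add: lagrangian_def o_def)
  from dir_deriv_eq[OF c v this] show ?thesis
    by (simp add: dir_deriv_chart[OF f_C1 c v] dir_deriv_chart[OF h_C1 c v])
qed

lemma dir_deriv_aug_lagrangian:
  assumes v: "v \<in> tangent_space A x" and r: "r \<noteq> 0"
  shows "dir_deriv A x v (aug_lagrangian f E h r m)
    = dir_deriv A x v f + (\<Sum>j\<in>E. (r * h j x + m j) * dir_deriv A x v (h j))"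
proof -
  obtain c where c: "c \<in> A" "x \<in> fst c" by (rule chart_exists)
  have sq: "((\<lambda>y. ((h j \<circ> chart_inv c) y + m j / r)\<^sup>2) has_derivative
      (\<lambda>u. 2 * (h j x + m j / r) * dchart c (h j) x u)) (at (snd c x))" if j: "j \<in> E" for j
  proof -
    have "((\<lambda>y. (h j \<circ> chart_inv c) y + m j / r) has_derivative (\<lambda>u. dchart c (h j) x u + 0)) (at (snd c x))"
      by (intro has_derivative_add has_derivative_const Ck_fun_has_derivative h_C1 j c)
    from has_derivative_power[OF this, of 2] show ?thesis
      by (rule has_derivative_eq_rhs) (simp add: chart_inv_chart[OF c] fun_eq_iff algebra_simps)
  qed
  have "((\<lambda>y. (f \<circ> chart_inv c) y + r / 2 * (\<Sum>j\<in>E. ((h j \<circ> chart_inv c) y + m j / r)\<^sup>2)) has_derivative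
      (\<lambda>u. dchart c f x u + r / 2 * (\<Sum>j\<in>E. 2 * (h j x + m j / r) * dchart c (h j) x u))) (at (snd c x))"
    by (intro has_derivative_add has_derivative_sum has_derivative_mult_right
        Ck_fun_has_derivative f_C1 sq c)
  then have "(aug_lagrangian f E h r m \<circ> chart_inv c has_derivative
      (\<lambda>u. dchart c f x u + r / 2 * (\<Sum>j\<in>E. 2 * (h j x + m j / r) * dchart c (h j) x u))) (at (snd c x))"
    by (simp add: aug_lagrangian_def o_def)
  from dir_deriv_eq[OF c v this]
  have "dir_deriv A x v (aug_lagrangian f E h r m)
    = dir_deriv A x v f + (\<Sum>j\<in>E. r / 2 * (2 * (h j x + m j / r) * dir_deriv A x v (h j)))"
    by (simp add: dir_deriv_chart[OF f_C1 c v] dir_deriv_chart[OF h_C1 c v] sum_distrib_left)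
  also have "(\<Sum>j\<in>E. r / 2 * (2 * (h j x + m j / r) * dir_deriv A x v (h j)))
      = (\<Sum>j\<in>E. (r * h j x + m j) * dir_deriv A x v (h j))"
    using r by (intro sum.cong refl) (simp add: field_simps)
  finally show ?thesis .
qed

lemma grad_lagrangian:
  "grad A g (lagrangian f E h m) x = grad A g f x + (\<Sum>j\<in>E. m j *\<^sub>R grad A g (h j) x)"
  by (rule grad_combination[OF dir_deriv_lagrangian])

lemma grad_aug_lagrangian:
  "r \<noteq> 0 \<Longrightarrow> grad A g (aug_lagrangian f E h r m) x
    = grad A g f x + (\<Sum>j\<in>E. (r * h j x + m j) *\<^sub>R grad A g (h j) x)"
  by (rule grad_combination[OF dir_deriv_aug_lagrangian])

lemma Hess_lagrangian:
  assumes v: "v \<in> tangent_space A x"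
  shows "Hess A g nabla (lagrangian f E h m) x v
    = Hess A g nabla f x v + (\<Sum>j\<in>E. m j *\<^sub>R Hess A g nabla (h j) x v)"
proof -
  have "grad A g (lagrangian f E h m) = (\<lambda>p. grad A g f p + (\<Sum>j\<in>E. m j *\<^sub>R grad A g (h j) p))"
    using grad_lagrangian by (rule ext)
  then show ?thesis
    using nabla_combination(2)[where m = "\<lambda>j _. m j", OF Ck_fun_const v]
    by (simp only: Hess_def[of A g nabla "lagrangian f E h m"] dir_deriv_const[OF v] scale_zero_left add_0_left)
qed

lemma Hess_aug_lagrangian:
  assumes v: "v \<in> tangent_space A x" and r: "r \<noteq> 0"
  shows "Hess A g nabla (aug_lagrangian f E h r m) x v
    = Hess A g nabla f x v + (\<Sum>j\<in>E. (r * dir_deriv A x v (h j)) *\<^sub>R grad A g (h j) x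
        + (r * h j x + m j) *\<^sub>R Hess A g nabla (h j) x v)"
proof -
  have "grad A g (aug_lagrangian f E h r m)
      = (\<lambda>p. grad A g f p + (\<Sum>j\<in>E. (r * h j p + m j) *\<^sub>R grad A g (h j) p))"
    using grad_aug_lagrangian[OF r] by (rule ext)
  then have "Hess A g nabla (aug_lagrangian f E h r m) x v = Hess A g nabla f x v
      + (\<Sum>j\<in>E. dir_deriv A x v (\<lambda>p. r * h j p + m j) *\<^sub>R grad A g (h j) x
        + (r * h j x + m j) *\<^sub>R Hess A g nabla (h j) x v)"
    using nabla_combination(2)[where m = "\<lambda>j p. r * h j p + m j", OF Ck_fun_affine[OF h_C1] v]
    by (simp only: Hess_def[of A g nabla "aug_lagrangian f E h r m"])
  then show ?thesis by (simp add: dir_deriv_affine[OF h_C1 v] cong: sum.cong)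
qed

lemma Hess_aug_lagrangian_tangent:
  assumes v: "v \<in> tangent_space A x" and r: "r \<noteq> 0"
  shows "Hess A g nabla (aug_lagrangian f E h r m) x v \<in> tangent_space A x"
  unfolding Hess_aug_lagrangian[OF assms]
  by (intro tangent_intros(2,4,5) Hess_tangent f_C2 h_C2 grad_tangent h_C1 v)

text \<open>In this form the penalty contributes \<open>r\<close> times a product of two
  differentials: visibly symmetric in \<open>v\<close> and \<open>w\<close>, and zero when the
  constraint differentials vanish on \<open>v\<close>.\<close>

lemma g_Hess_aug_lagrangian:
  assumes v: "v \<in> tangent_space A x" and w: "w \<in> tangent_space A x" and r: "r \<noteq> 0"
  shows "g x (Hess A g nabla (aug_lagrangian f E h r m) x v) w
    = g x (Hess A g nabla f x v) w + (\<Sum>j\<in>E. r * dir_deriv A x v (h j) * dir_deriv A x w (h j)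
        + (r * h j x + m j) * g x (Hess A g nabla (h j) x v) w)"
proof -
  let ?s = "\<lambda>j. (r * dir_deriv A x v (h j)) *\<^sub>R grad A g (h j) x
        + (r * h j x + m j) *\<^sub>R Hess A g nabla (h j) x v"
  have S: "?s j \<in> tangent_space A x" if "j \<in> E" for j
    by (intro tangent_intros(2,4) Hess_tangent h_C2 grad_tangent h_C1 v that)
  have "g x (Hess A g nabla f x v + sum ?s E) w = g x (Hess A g nabla f x v) w + g x (sum ?s E) w"
    by (intro g_add_left Hess_tangent f_C2 tangent_intros(5) S v w)
  also have "g x (sum ?s E) w = (\<Sum>j\<in>E. g x (?s j) w)"
    by (intro g_sum_left S w)
  also have "\<dots> = (\<Sum>j\<in>E. r * dir_deriv A x v (h j) * dir_deriv A x w (h j)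
        + (r * h j x + m j) * g x (Hess A g nabla (h j) x v) w)"
  proof (rule sum.cong[OF refl])
    fix j assume j: "j \<in> E"
    show "g x (?s j) w = r * dir_deriv A x v (h j) * dir_deriv A x w (h j)
        + (r * h j x + m j) * g x (Hess A g nabla (h j) x v) w"
      unfolding g_lin[OF grad_tangent[OF h_C1[OF j]] Hess_tangent[OF h_C2[OF j] v] w]
      by (simp only: g_grad[OF h_C1[OF j] w])
  qed
  finally show ?thesis unfolding Hess_aug_lagrangian[OF v r] .
qed

text \<open>
  On vectors annihilated by the differentials of the constraints the term carrying the factor \<open>r\<close>
  alone, which is unbounded as the penalty grows, disappears.
\<close>

lemma aug_lagrangian_quadratic_form_ge:
  assumes r: "r \<noteq> 0" and v: "v \<in> tangent_space A x"
    and ev: "\<And>\<mu>. \<mu> \<in> eigenvalues_on (tangent_space A x)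
      (Hess A g nabla (aug_lagrangian f E h r m) x) \<Longrightarrow> \<mu> \<ge> - \<epsilon>"
    and orth: "\<And>j. j \<in> E \<Longrightarrow> dir_deriv A x v (h j) = 0"
  shows "- \<epsilon> * g x v v \<le> g x v (Hess A g nabla f x v)
    + (\<Sum>j\<in>E. (r * h j x + m j) * g x v (Hess A g nabla (h j) x v))"
proof -
  let ?H = "Hess A g nabla (aug_lagrangian f E h r m) x"
  \<comment> \<open>Regularity is read off from the explicit formula for the gradient; it makes the
    linearity axioms of \<open>nabla\<close> available for the Hessian.\<close>
  have C1: "Ck_vfield A 1 (grad A g (aug_lagrangian f E h r m))"
  proof -
    have "grad A g (aug_lagrangian f E h r m)
        = (\<lambda>p. grad A g f p + (\<Sum>j\<in>E. (r * h j p + m j) *\<^sub>R grad A g (h j) p))"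
      using grad_aug_lagrangian[OF r] by (rule ext)
    then show ?thesis
      using Ck_combination[where m = "\<lambda>j p. r * h j p + m j", OF Ck_fun_affine[OF h_C1]]
      by (simp only:)
  qed
  have "- \<epsilon> * g x v v \<le> g x v (?H v)"
  proof (rule quadratic_form_ge_of_eigenvalues_ge)
    show "?H u \<in> tangent_space A x" if "u \<in> tangent_space A x" for u
      by (rule Hess_aug_lagrangian_tangent[OF that r])
    show "?H (u + w) = ?H u + ?H w" if "u \<in> tangent_space A x" "w \<in> tangent_space A x" for u w
      unfolding Hess_def by (rule nabla_add_direction[OF C1 that])
    show "?H (a *\<^sub>R u) = a *\<^sub>R ?H u" if "u \<in> tangent_space A x" for a u
      unfolding Hess_def by (rule nabla_scale_direction[OF C1 that])
    show "g x (?H u) w = g x (?H w) u" if uw: "u \<in> tangent_space A x" "w \<in> tangent_space A x" for u w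
      unfolding g_Hess_aug_lagrangian[OF uw r] g_Hess_aug_lagrangian[OF uw(2,1) r]
        Hess_symmetric[OF f_C2 uw]
      by (intro arg_cong2[where f = "(+)"] sum.cong refl)
        (simp_all add: Hess_symmetric[OF h_C2 uw] mult.commute mult.left_commute)
  qed (fact ev v)+
  also have "g x v (?H v) = g x (?H v) v"
    by (rule g_sym[OF v Hess_aug_lagrangian_tangent[OF v r]])
  also have "\<dots> = g x (Hess A g nabla f x v) v
      + (\<Sum>j\<in>E. (r * h j x + m j) * g x (Hess A g nabla (h j) x v) v)"
    unfolding g_Hess_aug_lagrangian[OF v v r] by (simp add: orth cong: sum.cong)
  also have "\<dots> = g x v (Hess A g nabla f x v)
      + (\<Sum>j\<in>E. (r * h j x + m j) * g x v (Hess A g nabla (h j) x v))"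
    using g_sym[OF v Hess_tangent[OF f_C2 v]] g_sym[OF v Hess_tangent[OF h_C2 v]]
    by (simp cong: sum.cong)
  finally show ?thesis .
qed

lemma g_Hess_lagrangian:
  assumes v: "v \<in> tangent_space A x"
  shows "g x v (Hess A g nabla (lagrangian f E h m) x v)
    = g x v (Hess A g nabla f x v) + (\<Sum>j\<in>E. m j * g x v (Hess A g nabla (h j) x v))"
proof -
  have S: "m j *\<^sub>R Hess A g nabla (h j) x v \<in> tangent_space A x" if "j \<in> E" for j
    by (intro tangent_intros(4) Hess_tangent h_C2 v that)
  have "g x v (Hess A g nabla f x v + (\<Sum>j\<in>E. m j *\<^sub>R Hess A g nabla (h j) x v))
      = g x v (Hess A g nabla f x v) + g x v (\<Sum>j\<in>E. m j *\<^sub>R Hess A g nabla (h j) x v)"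
    by (intro g_add_right Hess_tangent f_C2 tangent_intros(5) S v)
  also have "g x v (\<Sum>j\<in>E. m j *\<^sub>R Hess A g nabla (h j) x v)
      = (\<Sum>j\<in>E. g x v (m j *\<^sub>R Hess A g nabla (h j) x v))"
    by (intro g_sum_right S v)
  also have "\<dots> = (\<Sum>j\<in>E. m j * g x v (Hess A g nabla (h j) x v))"
    by (intro sum.cong refl g_scale_right Hess_tangent h_C2 v)
  finally show ?thesis unfolding Hess_lagrangian[OF v] .
qed

text \<open>Pairing \<open>partials\<close> with coordinates is the metric pairing with the
  gradient. A relation among the coordinate differentials therefore makes the same combination of
  gradients orthogonal to the whole tangent space, hence zero.\<close>

lemma lin_indep_family_partials:
  assumes c: "c \<in> A" "p \<in> fst c" and L: "LICQ A g E h p"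
  shows "lin_indep_family E (\<lambda>j. partials c (h j) p)"
  unfolding lin_indep_family_def
proof (intro allI impI)
  fix d assume z: "(\<Sum>j\<in>E. d j *\<^sub>R partials c (h j) p) = 0"
  have ind: "lin_indep_family E (\<lambda>j. grad A g (h j) p)"
    using L finite_E unfolding LICQ_def by (intro lin_indep_familyI) auto
  have S: "d j *\<^sub>R grad A g (h j) p \<in> tangent_space A p" if "j \<in> E" for j
    by (intro tangent_intros(4) grad_tangent h_C1 that)
  have "(\<Sum>j\<in>E. d j *\<^sub>R grad A g (h j) p) = 0"
  proof (rule g_eq_imp_eq)
    fix w assume w: "w \<in> tangent_space A p"
    have "g p (\<Sum>j\<in>E. d j *\<^sub>R grad A g (h j) p) w = (\<Sum>j\<in>E. g p (d j *\<^sub>R grad A g (h j) p) w)"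
      by (intro g_sum_left S w)
    also have "\<dots> = (\<Sum>j\<in>E. d j * (partials c (h j) p \<bullet> w c))"
      by (intro sum.cong refl)
        (simp only: g_scale_left[OF grad_tangent[OF h_C1] w] g_grad[OF h_C1 w]
          partials_inner[OF h_C1 c] lift_vec_of_tangent[OF w c])
    also have "\<dots> = (\<Sum>j\<in>E. d j *\<^sub>R partials c (h j) p) \<bullet> w c"
      by (simp add: inner_sum_left)
    also have "\<dots> = g p 0 w" using z g_zero_left[OF w] by simp
    finally show "g p (\<Sum>j\<in>E. d j *\<^sub>R grad A g (h j) p) w = g p 0 w" .
  qed (intro tangent_intros(1,5) S, assumption?)+
  then show "\<forall>j\<in>E. d j = 0" using ind unfolding lin_indep_family_def by blast
qed

end

section \<open>First- and second-order conditions in the limit\<close>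

context equality_constrained_problem
begin

text \<open>Stated for an arbitrary sequence with its own penalties, multipliers and tolerances, so
  that a subsequence of the iterates can be inserted together with the parameters that produced
  it.\<close>

lemma WSONC_limit:
  fixes X :: "nat \<Rightarrow> 'a" and R \<epsilon> :: "nat \<Rightarrow> real" and m :: "nat \<Rightarrow> 'j \<Rightarrow> real"
  assumes feasible: "p \<in> feasible_set E h" and LICQ: "LICQ A g E h p"
    and X: "X \<longlonglongrightarrow> p" and R: "\<And>i. R i \<noteq> 0" and \<epsilon>: "\<epsilon> \<longlonglongrightarrow> 0"
    and stationary: "\<And>i. tnorm g (X i) (grad A g (aug_lagrangian f E h (R i) (m i)) (X i)) < \<epsilon> i"
    and curvature: "\<And>i \<mu>. \<mu> \<in> eigenvalues_on (tangent_space A (X i))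
      (Hess A g nabla (aug_lagrangian f E h (R i) (m i)) (X i)) \<Longrightarrow> \<mu> \<ge> - \<epsilon> i"
  shows "WSONC A g nabla f E h p"
proof -
  obtain c where c: "c \<in> A" "p \<in> fst c" by (rule chart_exists)
  have dom: "\<forall>\<^sub>F i in sequentially. X i \<in> fst c"
    using topological_tendstoD[OF X open_chart_domain[OF c(1)] c(2)] .
  \<comment> \<open>The multiplier update before clipping.\<close>
  define \<mu> where "\<mu> j i = R i * h j (X i) + m i j" for j i
  have Dh: "(\<lambda>i. partials c (h j) (X i)) \<longlonglongrightarrow> partials c (h j) p" if "j \<in> E" for j
    by (rule chart_tendsto[OF c X continuous_on_partials[OF h_C1[OF that] c(1)]])
  have Df: "(\<lambda>i. partials c f (X i)) \<longlonglongrightarrow> partials c f p"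
    by (rule chart_tendsto[OF c X continuous_on_partials[OF f_C1 c(1)]])
  note indep = lin_indep_family_partials[OF c LICQ]
  let ?G = "\<lambda>i. partials c f (X i) + (\<Sum>j\<in>E. \<mu> j i *\<^sub>R partials c (h j) (X i))"

  \<comment> \<open>Against a fixed coordinate vector \<open>b\<close>, the coordinate differential
    equals the metric pairing of the gradient with the lift of \<open>b\<close>. Cauchy-Schwarz
    bounds it by \<open>\<epsilon> i\<close> times the norm of that lift, and this norm
    converges.\<close>
  have "(\<lambda>i. ?G i \<bullet> b) \<longlonglongrightarrow> 0" for b
  proof (rule Lim_null_comparison)
    have "(\<lambda>i. \<epsilon> i * sqrt (gchart c (X i) b b)) \<longlonglongrightarrow> 0 * sqrt (gchart c p b b)"
      by (intro tendsto_mult tendsto_real_sqrt \<epsilon> gchart_tendsto c X tendsto_const)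
    then show "(\<lambda>i. \<epsilon> i * sqrt (gchart c (X i) b b)) \<longlonglongrightarrow> 0" by simp
    show "\<forall>\<^sub>F i in sequentially. norm (?G i \<bullet> b) \<le> \<epsilon> i * sqrt (gchart c (X i) b b)"
      using dom
    proof eventually_elim
      case (elim i)
      let ?L = "aug_lagrangian f E h (R i) (m i)" and ?v = "lift_vec A c (X i) b"
      note v = lift_vec_in_tangent_space[OF c(1) elim, of b]
      have T: "grad A g ?L (X i) \<in> tangent_space A (X i)"
        unfolding grad_aug_lagrangian[OF R]
        by (intro tangent_intros(2,4,5) grad_tangent f_C1 h_C1)
      have "?G i \<bullet> b = dir_deriv A (X i) ?v f + (\<Sum>j\<in>E. \<mu> j i * dir_deriv A (X i) ?v (h j))"
        by (simp add: inner_add_left inner_sum_left partials_inner[OF f_C1 c(1) elim]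
            partials_inner[OF h_C1 c(1) elim] cong: sum.cong)
      also have "\<dots> = g (X i) (grad A g ?L (X i)) ?v"
      proof -
        have "g (X i) (grad A g ?L (X i)) ?v = g (X i) (grad A g f (X i)) ?v
            + g (X i) (\<Sum>j\<in>E. \<mu> j i *\<^sub>R grad A g (h j) (X i)) ?v"
          unfolding grad_aug_lagrangian[OF R] \<mu>_def
          by (intro g_add_left tangent_intros(4,5) grad_tangent f_C1 h_C1 v)
        also have "g (X i) (\<Sum>j\<in>E. \<mu> j i *\<^sub>R grad A g (h j) (X i)) ?v
            = (\<Sum>j\<in>E. g (X i) (\<mu> j i *\<^sub>R grad A g (h j) (X i)) ?v)"
          by (intro g_sum_left tangent_intros(4) grad_tangent h_C1 v)
        also have "\<dots> = (\<Sum>j\<in>E. \<mu> j i * dir_deriv A (X i) ?v (h j))"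
          by (intro sum.cong refl)
            (simp only: g_scale_left[OF grad_tangent[OF h_C1] v] g_grad[OF h_C1 v])
        finally show ?thesis unfolding g_grad[OF f_C1 v] by (rule sym)
      qed
      finally have "norm (?G i \<bullet> b) \<le> tnorm g (X i) (grad A g ?L (X i)) * tnorm g (X i) ?v"
        using g_Cauchy_Schwarz[OF T v] by simp
      also have "\<dots> \<le> \<epsilon> i * tnorm g (X i) ?v"
        using stationary[of i] g_nonneg[OF v] by (intro mult_right_mono) (auto simp: tnorm_def)
      finally show ?case by (simp add: tnorm_def)
    qed
  qed
  then have "\<forall>b\<in>Basis. (\<lambda>i. ?G i \<bullet> b) \<longlonglongrightarrow> 0 \<bullet> b" by simp
  then have "?G \<longlonglongrightarrow> 0" by (rule tendsto_componentwise_iff[THEN iffD2])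
  from tendsto_diff[OF this Df]
  have G: "(\<lambda>i. \<Sum>j\<in>E. \<mu> j i *\<^sub>R partials c (h j) (X i)) \<longlonglongrightarrow> - partials c f p" by simp
  obtain d where d: "\<And>j. j \<in> E \<Longrightarrow> \<mu> j \<longlonglongrightarrow> d j"
    by (rule tendsto_coefficients[OF finite_E indep Dh G]) blast+
  \<comment> \<open>Only the existence of the limits \<open>d j\<close> is known so far; uniqueness
    of the limit of the combination turns them into KKT multipliers.\<close>
  have "(\<lambda>i. \<Sum>j\<in>E. \<mu> j i *\<^sub>R partials c (h j) (X i)) \<longlonglongrightarrow> (\<Sum>j\<in>E. d j *\<^sub>R partials c (h j) p)"
    by (intro tendsto_sum tendsto_scaleR d Dh)
  then have stat: "(\<Sum>j\<in>E. d j *\<^sub>R partials c (h j) p) = - partials c f p"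
    using G by (rule LIMSEQ_unique)

  have "grad A g (lagrangian f E h d) p = 0"
  proof (rule grad_eqI)
    fix v assume v: "v \<in> tangent_space A p"
    have "dir_deriv A p v (lagrangian f E h d)
        = (partials c f p + (\<Sum>j\<in>E. d j *\<^sub>R partials c (h j) p)) \<bullet> v c"
      unfolding dir_deriv_lagrangian[OF v] inner_add_left inner_sum_left inner_scaleR_left
        partials_inner[OF f_C1 c] lift_vec_of_tangent[OF v c]
      by (intro arg_cong2[where f = "(+)"] sum.cong refl)
        (simp only: partials_inner[OF h_C1 c] lift_vec_of_tangent[OF v c])
    then show "g p 0 v = dir_deriv A p v (lagrangian f E h d)"
      using stat g_zero_left[OF v] by simp
  qed (rule tangent_intros(1))
  then have KKT: "KKT A g f E h p d"
    using feasible unfolding KKT_def grad_lagrangian feasible_set_def by blast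

  have "g p v (Hess A g nabla (lagrangian f E h d) p v) \<ge> 0"
    if cone: "v \<in> weak_critical_cone A g E h p" for v
  proof -
    have v: "v \<in> tangent_space A p" and orth: "\<And>j. j \<in> E \<Longrightarrow> g p (grad A g (h j) p) v = 0"
      using cone unfolding weak_critical_cone_def by blast+
    have "partials c (h j) p \<bullet> v c = 0" if "j \<in> E" for j
      unfolding partials_inner[OF h_C1[OF that] c] lift_vec_of_tangent[OF v c]
      using orth[OF that] g_grad[OF h_C1[OF that] v] by simp
    \<comment> \<open>The projection is orthogonal for the Euclidean inner product of the chart, not
      for the metric; all that matters is exact membership in the kernels and convergence to
      \<open>v c\<close>.\<close>
    then obtain u where u: "u \<longlonglongrightarrow> v c"
      and ker: "\<And>i j. j \<in> E \<Longrightarrow> partials c (h j) (X i) \<bullet> u i = 0"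
      using tendsto_kernel_vector[OF finite_E indep Dh] by metis
    let ?v = "\<lambda>i. lift_vec A c (X i) (u i)"
    let ?Q = "\<lambda>\<phi> i. g (X i) (?v i) (Hess A g nabla \<phi> (X i) (?v i))"
    have Q: "?Q \<phi> \<longlonglongrightarrow> g p v (Hess A g nabla \<phi> p v)" if "Ck_fun A 2 \<phi>" for \<phi>
      using Hess_quadratic_form_tendsto[OF c X u that] unfolding lift_vec_of_tangent[OF v c] .
    have "(\<lambda>i. ?Q f i + (\<Sum>j\<in>E. \<mu> j i * ?Q (h j) i))
        \<longlonglongrightarrow> g p v (Hess A g nabla f p v) + (\<Sum>j\<in>E. d j * g p v (Hess A g nabla (h j) p v))"
      by (intro tendsto_add tendsto_sum tendsto_mult Q d f_C2 h_C2)
    then have lim: "(\<lambda>i. ?Q f i + (\<Sum>j\<in>E. \<mu> j i * ?Q (h j) i))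
        \<longlonglongrightarrow> g p v (Hess A g nabla (lagrangian f E h d) p v)"
      unfolding g_Hess_lagrangian[OF v] .
    \<comment> \<open>The squared norms of the corrected vectors converge, so the tolerance drives
      the lower bound to 0.\<close>
    have "(\<lambda>i. - \<epsilon> i * g (X i) (?v i) (?v i)) \<longlonglongrightarrow> - 0 * g p (lift_vec A c p (v c)) (lift_vec A c p (v c))"
      by (intro tendsto_mult tendsto_minus \<epsilon> gchart_tendsto c X u)
    then have lim0: "(\<lambda>i. - \<epsilon> i * g (X i) (?v i) (?v i)) \<longlonglongrightarrow> 0" by simp
    have "\<forall>\<^sub>F i in sequentially. - \<epsilon> i * g (X i) (?v i) (?v i) \<le> ?Q f i + (\<Sum>j\<in>E. \<mu> j i * ?Q (h j) i)"
      using dom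
    proof eventually_elim
      case (elim i)
      show ?case
        unfolding \<mu>_def
      proof (rule aug_lagrangian_quadratic_form_ge[OF R lift_vec_in_tangent_space[OF c(1) elim] curvature])
        show "dir_deriv A (X i) (?v i) (h j) = 0" if "j \<in> E" for j
          using ker[OF that, of i] partials_inner[OF h_C1[OF that] c(1) elim, of "u i"] by simp
      qed
    qed
    then show ?thesis by (rule tendsto_le[OF sequentially_bot lim lim0])
  qed
  with KKT feasible show ?thesis unfolding WSONC_def by blast
qed

end

theorem proposition3p4:
  fixes A :: "('a::{t2_space, second_countable_topology}, 'e::euclidean_space) chart set"
    and g :: "('a, 'e) metric"
    and nabla :: "'a \<Rightarrow> ('a, 'e) tvec \<Rightarrow> ('a, 'e) vfield \<Rightarrow> ('a, 'e) tvec"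
    and E :: "'j set" and f :: "'a \<Rightarrow> real" and h :: "'j \<Rightarrow> 'a \<Rightarrow> real"
    and P :: "('a, 'j) ralm_input"
    and x :: "nat \<Rightarrow> 'a" and \<gamma> :: "nat \<Rightarrow> 'j \<Rightarrow> real" and \<epsilon> \<rho> :: "nat \<Rightarrow> real"
    and r :: "nat \<Rightarrow> nat" and xbar :: 'a
  assumes "smooth_manifold A" and "riemannian_metric A g" and "riem_complete A g"
    and "riemannian_connection A g nabla"
    and "finite E" and "card E < DIM('e)"
    and "Ck_fun A 2 f" and "\<And>j. j \<in> E \<Longrightarrow> Ck_fun A 2 (h j)"
    and "valid_ralm_input E P" and "eps_min P = 0"
    and "ralm_run A g E h P x \<gamma> \<epsilon> \<rho>"
    and "\<And>k. tnorm g (x (Suc k)) (grad A g (aug_lagrangian f E h (\<rho> k) (\<gamma> k)) (x (Suc k))) < \<epsilon> k"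
    and "\<And>k \<mu>. \<mu> \<in> eigenvalues_on (tangent_space A (x (Suc k)))
            (Hess A g nabla (aug_lagrangian f E h (\<rho> k) (\<gamma> k)) (x (Suc k))) \<Longrightarrow> \<mu> \<ge> - \<epsilon> k"
    and "strict_mono r" and "(x \<circ> r) \<longlonglongrightarrow> xbar"
    and "xbar \<in> feasible_set E h" and "LICQ A g E h xbar"
  shows "WSONC A g nabla f E h xbar"
proof -
  interpret equality_constrained_problem A g nabla E f h
    by unfold_locales (fact assms)+
  have valid: "eps_init P > 0" "rho_init P > 0" "0 < theta_eps P" "theta_eps P < 1" "theta_rho P > 1"
    using assms(9) unfolding valid_ralm_input_def by blast+
  have run: "\<epsilon> 0 = eps_init P" "\<rho> 0 = rho_init P"
    "\<And>k. \<epsilon> (Suc k) = max (eps_min P) (theta_eps P * \<epsilon> k)"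
    "\<And>k. \<rho> (Suc k) =
        (if k = 0 \<or> max_violation E h (x (Suc k)) \<le> theta_sigma P * max_violation E h (x k)
         then \<rho> k else theta_rho P * \<rho> k)"
    using assms(11) unfolding ralm_run_def by blast+
  have \<epsilon>_eq: "\<epsilon> k = theta_eps P ^ k * eps_init P" for k
  proof (induction k)
    case (Suc k)
    \<comment> \<open>Since \<open>eps_min P = 0\<close>, nonnegativity of the product makes the
      maximum in the update equal to the product, and the tolerances decay geometrically.\<close>
    have "0 \<le> theta_eps P * (theta_eps P ^ k * eps_init P)" using valid by simp
    then show ?case unfolding run(3) Suc assms(10) by (simp add: mult.assoc)
  qed (simp add: run(1))
  have "(\<lambda>k. theta_eps P ^ k * eps_init P) \<longlonglongrightarrow> 0 * eps_init P"
    using valid by (intro tendsto_mult LIMSEQ_power_zero tendsto_const) simp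
  then have \<epsilon>: "\<epsilon> \<longlonglongrightarrow> 0" unfolding \<epsilon>_eq[abs_def] by simp
  have \<rho>: "\<rho> k > 0" for k
  proof (induction k)
    case (Suc k)
    then show ?case using valid unfolding run(4) by simp
  qed (simp add: run(2) valid)

  \<comment> \<open>The subsolver conditions at step \<open>k\<close> concern
    \<open>x (Suc k)\<close>, so each index of the subsequence is written as a successor. Starting
    from \<open>r (Suc i)\<close>, which is at least 1, makes the subtraction on natural numbers
    exact.\<close>
  define k where "k i = r (Suc i) - 1" for i
  have Suc_k: "Suc (k i) = r (Suc i)" and k_ge: "i \<le> k i" for i
    using seq_suble[OF assms(14), of "Suc i"] unfolding k_def by simp_all
  show ?thesis
  proof (rule WSONC_limit[where X = "\<lambda>i. x (Suc (k i))" and R = "\<lambda>i. \<rho> (k i)"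
        and m = "\<lambda>i. \<gamma> (k i)" and \<epsilon> = "\<lambda>i. \<epsilon> (k i)"])
    show "(\<lambda>i. x (Suc (k i))) \<longlonglongrightarrow> xbar"
      using LIMSEQ_Suc[OF assms(15)] unfolding Suc_k by simp
    show "\<rho> (k i) \<noteq> 0" for i using \<rho>[of "k i"] by simp
    have "filterlim k at_top sequentially"
      by (rule filterlim_at_top_mono[OF filterlim_ident]) (simp add: k_ge)
    with \<epsilon> show "(\<lambda>i. \<epsilon> (k i)) \<longlonglongrightarrow> 0" by (rule filterlim_compose)
  qed (fact assms)+
qed

end
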